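(* Let $k \geq 3$ be an integer and let $n$ be a nonzero integer. If $|n|=1$, then $BM_k(n)\leq r_k+1$, where $r_3=9$, $r_4=6$, $r_5=5$, and $r_k=4$ for $k \geq 6$. If $|n|\geq 2$, then $$BM_k(n) \leq \max\left\{\frac{\log \log |n|+3.3}{\log (k-1)}+8,\ \left(\max\{4|n|^2,|n|^{2(k+1)/(k-2)}\}+n\right)^{1/k}+20\right\}.$$
   Context: $\mathbb{N}$ denotes the set of positive integers and $\log$ is the natural logarithm. For an integer $k\ge 3$ and a nonzero integer $n$, a pair $(A,B)$ of subsets of $\mathbb{N}$ is said to have property $BD_k(n)$ if $|A|,|B|\geq 2$ and $ab+n\in\{x^k: x\in\mathbb{N}\}$ for every $a\in A$ and $b\in B$. Define $BM_k(n)=\sup\{\min\{|A|,|B|\}: (A,B)\text{ has property } BD_k(n)\}$. *)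

theory Defs
  imports Complex_Main "HOL-Library.Extended_Real"
begin

text \<open>
  \<^const>\<open>card\<close> is \<open>0\<close> on infinite sets, so the sizes are taken in \<^typ>\<open>enat\<close>; all sets
  considered here are countable, so a single infinite value suffices.
\<close>

definition ecard :: "'a set \<Rightarrow> enat" where
  "ecard A = (if finite A then enat (card A) else \<infinity>)"

definition BD :: "nat \<Rightarrow> int \<Rightarrow> nat set \<Rightarrow> nat set \<Rightarrow> bool" where
  "BD k n A B \<longleftrightarrow>
     A \<subseteq> {1..} \<and> B \<subseteq> {1..} \<and> ecard A \<ge> 2 \<and> ecard B \<ge> 2 \<and>
     (\<forall>a\<in>A. \<forall>b\<in>B. int a * int b + n \<in> {int x ^ k | x :: nat. x \<ge> 1})"

text \<open>If no pair has the property, the supremum is that of the empty set, which is \<open>0\<close> in \<^typ>\<open>enat\<close>.\<close>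

definition BM :: "nat \<Rightarrow> int \<Rightarrow> enat" where
  "BM k n = Sup {min (ecard A) (ecard B) | A B. BD k n A B}"

definition r_bd :: "nat \<Rightarrow> nat" where
  "r_bd k = (if k = 3 then 9 else if k = 4 then 6 else if k = 5 then 5 else 4)"

end

theory Submission
  imports Defs "HOL-Analysis.Analysis" "HOL-Number_Theory.Cong"
begin

text \<open>
  Fix \<open>a < a'\<close> in \<open>A\<close>. Every \<open>b \<in> B\<close> gives a solution \<open>x\<^sup>k = ab + n\<close>, \<open>y\<^sup>k = a'b + n\<close> of the Thue equation
  \<open>a' x\<^sup>k - a y\<^sup>k = n (a' - a)\<close>, so that \<open>x / y\<close> is an excellent approximation to \<open>(a / a')\<^bsup>1/k\<^esup>\<close>.
  Following Thue and Siegel, one such solution \<open>b\<^sub>0\<close>, large compared with \<open>a'\<close> and \<open>n\<close>, is fed into the diagonal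
  Pade approximants of the \<open>k\<close>-th root; comparing the resulting approximations with those of a second
  solution \<open>b\<^sub>1 > b\<^sub>0\<close> produces nonzero integers of absolute value below \<open>1\<close>, unless \<open>b\<^sub>1\<close> is small.
  On the other hand, for \<open>a < a'\<close> and \<open>b < b'\<close> the integers \<open>(ab + n)(a'b' + n)\<close> and \<open>(ab' + n)(a'b + n)\<close> are
  distinct \<open>k\<close>-th powers that are close together, whence \<open>\<bar>n\<bar>\<^sup>k a'b' \<ge> (ab)\<^bsup>k - 1\<^esup>\<close>. This gap principle
  makes the elements grow doubly exponentially, so that a few elements beyond the initial range \<open>ab \<le> M\<close>,
  where \<open>M\<close> is the maximum of \<open>4n\<^sup>2\<close> and \<open>\<bar>n\<bar>\<^bsup>2(k+1)/(k-2)\<^esup>\<close>, already contain suitable \<open>b\<^sub>0\<close> and \<open>b\<^sub>1\<close>. For a fixed \<open>a\<close> that range contains at most \<open>(M + n)\<^bsup>1/k\<^esup>\<close> values of \<open>b\<close>,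
  one for each possible \<open>k\<close>-th root. This gives \<open>(M + n)\<^bsup>1/k\<^esup> + 20\<close> for all \<open>\<bar>n\<bar> \<ge> 2\<close>.
\<close>

section \<open>Integrality of binomial coefficients with rational upper index\<close>

text \<open>Only the multiples of \<open>p\<close> contribute, so the multiplicity of
  \<open>m!\<close> is \<open>q\<close> plus that of \<open>q!\<close>, where
  \<open>q = m div p\<close>. By induction this is at most \<open>2q\<close>, hence at most
  \<open>pq\<close> and \<open>m\<close>.\<close>

lemma multiplicity_fact_le:
  assumes "prime (p::nat)"
  shows "multiplicity p (fact m :: nat) \<le> m"
proof (induction m rule: less_induct)
  case (less m)
  have p: "p \<ge> 2" using assms prime_ge_2_nat by blast
  show ?case
  proof (cases "m = 0")
    case False
    define q where "q = m div p"
    have qm: "q < m" using False p by (simp add: q_def)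
    have M: "multiplicity p (fact m :: nat) = (\<Sum>i\<in>{1..m}. multiplicity p i)" for m :: nat
      unfolding fact_prod of_nat_id using assms
      by (subst prime_elem_multiplicity_prod_distrib) (auto simp: image_iff)
    have "(\<Sum>i\<in>{1..m}. multiplicity p i) = (\<Sum>i\<in>(\<lambda>j. p * j) ` {1..q}. multiplicity p i)"
    proof (rule sum.mono_neutral_right)
      show "(\<lambda>j. p * j) ` {1..q} \<subseteq> {1..m}"
      proof
        fix x assume "x \<in> (\<lambda>j. p * j) ` {1..q}"
        then obtain j where j: "x = p * j" "1 \<le> j" "j \<le> q"
          unfolding image_iff Bex_def atLeastAtMost_iff by blast
        have "p * j \<le> p * q" using j by simp
        also have "\<dots> \<le> m" by (simp add: q_def)
        finally show "x \<in> {1..m}" using j p by auto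
      qed
      show "\<forall>i\<in>{1..m} - (\<lambda>j. p * j) ` {1..q}. multiplicity p i = 0"
      proof
        fix i assume i: "i \<in> {1..m} - (\<lambda>j. p * j) ` {1..q}"
        have "\<not> p dvd i"
        proof
          assume "p dvd i"
          then obtain j where j: "i = p * j" by auto
          have "j = i div p" using j p by simp
          also have "\<dots> \<le> q" unfolding q_def using i by (intro div_le_mono) auto
          finally have "j \<in> {1..q}" using i j by (cases j) auto
          with i j show False by auto
        qed
        then show "multiplicity p i = 0" by (rule not_dvd_imp_multiplicity_0)
      qed
    qed auto
    also have "\<dots> = (\<Sum>j\<in>{1..q}. multiplicity p (p * j))"
      using p by (subst sum.reindex) (auto simp: inj_on_def)
    also have "\<dots> = (\<Sum>j\<in>{1..q}. 1 + multiplicity p j)"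
      using assms by (intro sum.cong refl, subst multiplicity_times_same) auto
    also have "\<dots> = q + multiplicity p (fact q :: nat)"
      by (simp only: sum.distrib M) simp
    also have "\<dots> \<le> q + q" using less.IH[OF qm] by simp
    also have "\<dots> \<le> p * q" using mult_le_mono1[OF p, of q] by linarith
    also have "\<dots> \<le> m" by (simp add: q_def)
    finally show ?thesis by (simp only: M)
  qed auto
qed

text \<open>Checked one prime at a time. If \<open>p\<close> divides \<open>k\<close>, the factor
  \<open>k^m\<close> already absorbs the power of \<open>p\<close> in \<open>m!\<close>. Otherwise
  \<open>k\<close> is invertible modulo that power, and multiplying by the inverse \<open>K\<close>
  turns the progression into \<open>m\<close> consecutive integers. This makes the Pade coefficients
  integral.\<close>

lemma fact_dvd_power_mult_prod:
  fixes k :: nat and x :: int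
  assumes "k > 0"
  shows "fact m dvd int k ^ m * (\<Prod>s<m. x + int k * int s)"
proof (cases "(\<Prod>s<m. x + int k * int s) = 0")
  case nz: False
  show ?thesis
  proof (rule multiplicity_le_imp_dvd)
    fix p :: int assume p: "prime p"
    define P where "P = (\<Prod>s<m. x + int k * int s)"
    have nu: "\<not> is_unit p" using p not_prime_unit by blast
    have nz': "int k ^ m * P \<noteq> 0" using nz assms by (simp add: P_def)
    define e where "e = multiplicity p (fact m :: int)"
    show "multiplicity p (fact m) \<le> multiplicity p (int k ^ m * P)"
    proof (cases "p dvd int k")
      case True
      have "e \<le> m"
      proof -
        obtain q where q: "p = int q" "prime q"
          using p by (metis prime_int_nat_transfer prime_ge_0_int int_nat_eq)
        have "p ^ e dvd fact m" unfolding e_def by (rule multiplicity_dvd)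
        then have "int (q ^ e) dvd int (fact m)" by (simp add: q)
        then have "q ^ e dvd fact m" by (simp only: of_nat_dvd_iff)
        then have "e \<le> multiplicity q (fact m :: nat)"
          using q(2) by (subst (asm) power_dvd_iff_le_multiplicity) auto
        then show ?thesis using multiplicity_fact_le[OF q(2), of m] by simp
      qed
      have "p ^ e dvd p ^ m" using \<open>e \<le> m\<close> by (rule le_imp_power_dvd)
      also have "p ^ m dvd int k ^ m" using True by (rule dvd_power_same)
      finally have "p ^ e dvd int k ^ m * P" by simp
      then show ?thesis using nz' nu by (simp add: e_def power_dvd_iff_le_multiplicity)
    next
      case False
      have "coprime (int k) (p ^ e)"
        using False p by (simp add: coprime_commute prime_imp_coprime)
      then obtain K where K: "[int k * K = 1] (mod p ^ e)"
        using cong_solve_coprime_int by blast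
      have "[(\<Prod>s<m. K * (x + int k * int s)) = (\<Prod>s<m. K * x + int s)] (mod p ^ e)"
      proof (rule cong_prod)
        fix s
        have "[K * x + (int k * K) * int s = K * x + 1 * int s] (mod p ^ e)"
          by (intro cong_add cong_mult cong_refl K)
        then show "[K * (x + int k * int s) = K * x + int s] (mod p ^ e)"
          by (simp add: algebra_simps)
      qed
      moreover have "p ^ e dvd (\<Prod>s<m. K * x + int s)"
      proof -
        have "p ^ e dvd fact m" unfolding e_def by (rule multiplicity_dvd)
        also have "fact m dvd pochhammer (K * x) m" by (rule fact_dvd_pochhammer)
        finally show ?thesis by (simp add: pochhammer_prod atLeast0LessThan)
      qed
      ultimately have "p ^ e dvd (\<Prod>s<m. K * (x + int k * int s))"
        by (simp add: cong_dvd_iff)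
      then have "p ^ e dvd K ^ m * P" by (simp add: prod.distrib P_def)
      moreover have "coprime (p ^ e) (K ^ m)"
      proof -
        have "coprime (int k * K) (p ^ e)" using K
          by (metis cong_imp_coprime coprime_1_left cong_sym)
        then show ?thesis by (auto simp: coprime_commute)
      qed
      ultimately have "p ^ e dvd P" by (simp add: coprime_dvd_mult_right_iff)
      then have "p ^ e dvd int k ^ m * P" by simp
      then show ?thesis using nz' nu by (simp add: e_def power_dvd_iff_le_multiplicity)
    qed
  qed (use nz assms in auto)
next
  case True
  show ?thesis unfolding True by simp
qed

section \<open>Divided differences of the exponential function\<close>

text \<open>This is the Lagrange form of the divided difference of \<open>exp (e * \<tau>)\<close>
  in the variable \<open>e\<close>. For natural nodes and \<open>\<tau> = ln t\<close> it is a
  polynomial in \<open>t\<close> that vanishes at \<open>t = 1\<close> to order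
  \<open>card S - 1\<close>.\<close>

definition exp_dd :: "real set \<Rightarrow> real \<Rightarrow> real" where
  "exp_dd S \<tau> = (\<Sum>e\<in>S. exp (e * \<tau>) / (\<Prod>j\<in>S - {e}. e - j))"

text \<open>The factor \<open>e - m\<close> kills the term of \<open>m\<close> and cancels in the
  denominators of the others. Both the recursion over node sets and the differential equation in
  \<tau> come from this.\<close>

lemma exp_dd_remove:
  assumes "finite S" "m \<in> S"
  shows "(\<Sum>e\<in>S. (e - m) * exp (e * \<tau>) / (\<Prod>j\<in>S - {e}. e - j)) = exp_dd (S - {m}) \<tau>"
proof -
  have "(\<Sum>e\<in>S. (e - m) * exp (e * \<tau>) / (\<Prod>j\<in>S - {e}. e - j))
      = (\<Sum>e\<in>S - {m}. (e - m) * exp (e * \<tau>) / (\<Prod>j\<in>S - {e}. e - j))"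
    using assms by (subst sum.remove[of S m]) auto
  also have "\<dots> = exp_dd (S - {m}) \<tau>" unfolding exp_dd_def
  proof (rule sum.cong[OF refl])
    fix e assume e: "e \<in> S - {m}"
    have "(\<Prod>j\<in>S - {e}. e - j) = (e - m) * (\<Prod>j\<in>S - {m} - {e}. e - j)"
      using prod.remove[of "S - {e}" m "\<lambda>j. e - j"] assms e
      by (simp add: Diff_insert2[symmetric] Diff_insert[symmetric] insert_commute)
    then show "(e - m) * exp (e * \<tau>) / (\<Prod>j\<in>S - {e}. e - j)
        = exp (e * \<tau>) / (\<Prod>j\<in>S - {m} - {e}. e - j)" using e by simp
  qed
  finally show ?thesis .
qed

text \<open>At \<open>\<tau> = 0\<close> the function is constant. Removing \<open>m\<close> or
  \<open>m'\<close> gives the usual recursion, since \<open>(e - m) - (e - m') = m' - m\<close>. It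
  starts at two nodes, where both one-point values are \<open>1\<close>.\<close>

lemma exp_dd_zero:
  assumes "finite S" "card S \<ge> 2"
  shows "exp_dd S 0 = 0"
  using assms
proof (induction "card S" arbitrary: S rule: less_induct)
  case less
  obtain m m' where m: "m \<in> S" "m' \<in> S" "m \<noteq> m'"
    using less.prems by (metis One_nat_def card_le_Suc0_iff_eq not_less_eq_eq numeral_2_eq_2)
  have eq: "(m' - m) * exp_dd S 0 = exp_dd (S - {m}) 0 - exp_dd (S - {m'}) 0"
    unfolding exp_dd_remove[OF less.prems(1) m(1), symmetric]
      exp_dd_remove[OF less.prems(1) m(2), symmetric]
    unfolding exp_dd_def sum_distrib_left sum_subtractf[symmetric]
    by (intro sum.cong refl) (simp add: diff_divide_distrib[symmetric])
  have "exp_dd (S - {m}) 0 = exp_dd (S - {m'}) 0"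
  proof (cases "card S = 2")
    case True
    then have "S = {m, m'}" using m less.prems(1)
      by (metis card_2_iff doubleton_eq_iff insertE singletonD)
    then have "S - {m} = {m'}" "S - {m'} = {m}" using m by auto
    then show ?thesis by (simp add: exp_dd_def)
  next
    case False
    then show ?thesis using less.hyps[of "S - {m}"] less.hyps[of "S - {m'}"] less.prems m
      by simp
  qed
  then show ?case using eq m by simp
qed

text \<open>Differentiation brings down \<open>e\<close>, which is split as
  \<open>m + (e - m)\<close>.\<close>

lemma exp_dd_has_derivative:
  assumes "finite S" "m \<in> S"
  shows "(exp_dd S has_real_derivative (m * exp_dd S \<tau> + exp_dd (S - {m}) \<tau>)) (at \<tau>)"
proof -
  have "(exp_dd S has_real_derivative
      (\<Sum>e\<in>S. e * exp (e * \<tau>) / (\<Prod>j\<in>S - {e}. e - j))) (at \<tau>)"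
    unfolding exp_dd_def[abs_def]
    by (intro DERIV_sum DERIV_cdivide) (auto intro!: derivative_eq_intros)
  also have "(\<Sum>e\<in>S. e * exp (e * \<tau>) / (\<Prod>j\<in>S - {e}. e - j))
      = m * exp_dd S \<tau> + exp_dd (S - {m}) \<tau>"
    unfolding exp_dd_remove[OF assms, symmetric]
    unfolding exp_dd_def sum_distrib_left sum.distrib[symmetric]
    by (intro sum.cong refl) (simp add: add_divide_distrib[symmetric] algebra_simps)
  finally show ?thesis .
qed

text \<open>The mean value form \<open>\<tau>^N * exp (\<xi> * \<tau>) / N!\<close> suggests these
  bounds. The integrating factors \<open>exp (- m * \<tau>)\<close> for the lower bound and
  \<open>exp (- M * \<tau>)\<close> for the upper one turn the differential equation into
  monotonicity.\<close>

lemma exp_dd_bounds: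
  assumes "finite S" "card S = Suc N" "\<And>e. e \<in> S \<Longrightarrow> e \<le> M" "\<tau> \<ge> 0"
  shows "0 \<le> exp_dd S \<tau> \<and> exp_dd S \<tau> \<le> \<tau> ^ N / fact N * exp (M * \<tau>)"
  using assms
proof (induction N arbitrary: S \<tau>)
  case 0
  then obtain m where S: "S = {m}" by (metis One_nat_def card_1_singletonE)
  have "m * \<tau> \<le> M * \<tau>" using 0 S by (intro mult_right_mono) auto
  then show ?case by (simp add: S exp_dd_def)
next
  case (Suc N)
  from Suc.prems obtain m where m: "m \<in> S"
    by (metis card.empty ex_in_conv nat.distinct(1))
  have c: "finite (S - {m})" "card (S - {m}) = Suc N" "\<And>e. e \<in> S - {m} \<Longrightarrow> e \<le> M"
    using Suc.prems m by auto
  have z: "exp_dd S 0 = 0" using Suc.prems by (intro exp_dd_zero) auto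
  have IH: "0 \<le> exp_dd (S - {m}) t \<and> exp_dd (S - {m}) t \<le> t ^ N / fact N * exp (M * t)" if "t \<ge> 0" for t
    using Suc.IH[OF c] that by blast
  have nonneg: "0 \<le> exp_dd S t" if t: "t \<ge> 0" for t
  proof -
    have "exp_dd S 0 * exp (- m * 0) \<le> exp_dd S t * exp (- m * t)"
    proof (rule DERIV_nonneg_imp_nondecreasing[OF t])
      fix x :: real assume x: "0 \<le> x" "x \<le> t"
      have "((\<lambda>x. exp_dd S x * exp (- m * x)) has_real_derivative
          exp_dd (S - {m}) x * exp (- m * x)) (at x)"
        by (rule derivative_eq_intros exp_dd_has_derivative[OF Suc.prems(1) m] refl)+
           (simp add: algebra_simps)
      moreover have "exp_dd (S - {m}) x * exp (- m * x) \<ge> 0" using IH x by simp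
      ultimately show "\<exists>y. ((\<lambda>x. exp_dd S x * exp (- m * x)) has_real_derivative y) (at x) \<and> 0 \<le> y"
        by blast
    qed
    then show ?thesis using z by (simp add: zero_le_mult_iff)
  qed
  have "0 ^ Suc N / fact (Suc N) - exp_dd S 0 * exp (- M * 0)
      \<le> \<tau> ^ Suc N / fact (Suc N) - exp_dd S \<tau> * exp (- M * \<tau>)"
  proof (rule DERIV_nonneg_imp_nondecreasing[OF Suc.prems(4)])
    fix x :: real assume x: "0 \<le> x" "x \<le> \<tau>"
    define y where "y = x ^ N / fact N - (exp_dd (S - {m}) x + (m - M) * exp_dd S x) * exp (- M * x)"
    have f: "real (Suc N) * x ^ N / fact (Suc N) = x ^ N / fact N"
      by (simp add: fact_Suc del: of_nat_Suc)
    have "((\<lambda>x. x ^ Suc N / fact (Suc N) - exp_dd S x * exp (- M * x)) has_real_derivative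
        (real (Suc N) * x ^ N / fact (Suc N) - (exp_dd (S - {m}) x + (m - M) * exp_dd S x) * exp (- M * x))) (at x)"
    proof (rule DERIV_diff)
      show "((\<lambda>x. x ^ Suc N / fact (Suc N)) has_real_derivative
          real (Suc N) * x ^ N / fact (Suc N)) (at x)"
        using DERIV_cdivide[OF DERIV_pow[of "Suc N" x], of "fact (Suc N)"] by simp
      show "((\<lambda>x. exp_dd S x * exp (- M * x)) has_real_derivative
          (exp_dd (S - {m}) x + (m - M) * exp_dd S x) * exp (- M * x)) (at x)"
        by (rule derivative_eq_intros exp_dd_has_derivative[OF Suc.prems(1) m] refl)+
           (simp add: algebra_simps)
    qed
    then have "((\<lambda>x. x ^ Suc N / fact (Suc N) - exp_dd S x * exp (- M * x)) has_real_derivative y) (at x)"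
      unfolding y_def f .
    moreover have "y \<ge> 0"
    proof -
      have "(m - M) * exp_dd S x \<le> 0" using nonneg[OF x(1)] Suc.prems(3)[OF m]
        by (simp add: mult_nonpos_nonneg)
      then have "(exp_dd (S - {m}) x + (m - M) * exp_dd S x) * exp (- M * x)
          \<le> (x ^ N / fact N * exp (M * x)) * exp (- M * x)"
        using IH[OF x(1)] by (intro mult_right_mono) auto
      also have "\<dots> = x ^ N / fact N" by (simp add: exp_minus)
      finally show ?thesis by (simp add: y_def)
    qed
    ultimately show "\<exists>y. ((\<lambda>x. x ^ Suc N / fact (Suc N) - exp_dd S x * exp (- M * x)) has_real_derivative y) (at x) \<and> 0 \<le> y"
      by blast
  qed
  then have "exp_dd S \<tau> * exp (- M * \<tau>) \<le> \<tau> ^ Suc N / fact (Suc N)" using z by simp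
  then have "exp_dd S \<tau> * exp (- M * \<tau>) * exp (M * \<tau>) \<le> \<tau> ^ Suc N / fact (Suc N) * exp (M * \<tau>)"
    by (rule mult_right_mono) simp
  also have "exp_dd S \<tau> * exp (- M * \<tau>) * exp (M * \<tau>) = exp_dd S \<tau>" by (simp add: exp_minus)
  finally show ?case using nonneg[OF Suc.prems(4)] by blast
qed

section \<open>Diagonal Pade approximants of the k-th root\<close>

text \<open>This is \<open>k^m\<close> times the rising factorial of length \<open>m\<close> at
  \<open>1 + \<epsilon>/k\<close>; the cases \<open>\<epsilon> = 1\<close> and
  \<open>\<epsilon> = -1\<close> occur.\<close>

definition prod_ap :: "nat \<Rightarrow> real \<Rightarrow> nat \<Rightarrow> real" where
  "prod_ap k \<epsilon> m = (\<Prod>s=1..m. real k * real s + \<epsilon>)"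

lemma prod_ap_0 [simp]: "prod_ap k \<epsilon> 0 = 1"
  by (simp add: prod_ap_def)

lemma prod_ap_Suc: "prod_ap k \<epsilon> (Suc m) = prod_ap k \<epsilon> m * (real k * real (Suc m) + \<epsilon>)"
  by (simp add: prod_ap_def mult.commute)

lemma prod_ap_pos: "k \<ge> 2 \<Longrightarrow> \<epsilon> \<ge> -1 \<Longrightarrow> prod_ap k \<epsilon> m > 0"
proof (unfold prod_ap_def, intro prod_pos)
  fix s assume *: "k \<ge> 2" "\<epsilon> \<ge> -1" "s \<in> {1..m}"
  have "2 * 1 \<le> real k * real s" using * by (intro mult_mono) auto
  then show "0 < real k * real s + \<epsilon>" using * by linarith
qed

text \<open>
  Up to a common factor, these are the coefficients of the divided difference of \<open>e \<mapsto> t\<^sup>e\<close> at the nodes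
  \<open>ki, ki + 1\<close> for \<open>i \<le> r\<close>, which vanishes to order \<open>2r + 1\<close> at \<open>t = 1\<close>; the factor makes them integers.
\<close>

definition pade_coeff :: "nat \<Rightarrow> nat \<Rightarrow> nat \<Rightarrow> real" where
  "pade_coeff k r i = real k ^ r * prod_ap k 1 r * prod_ap k (-1) r /
     (fact i * fact (r - i) * prod_ap k 1 i * prod_ap k (-1) (r - i))"

text \<open>Multiplied by \<open>k\<close>, the factors of the falling factorial are the
  \<open>m\<close> largest factors of \<open>prod_ap k \<epsilon> r\<close>.\<close>

lemma gbinomial_prod_ap:
  assumes "k > 0" "m \<le> r"
  shows "real k ^ m * fact m * ((real r + \<epsilon> / real k) gchoose m) * prod_ap k \<epsilon> (r - m) = prod_ap k \<epsilon> r"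
proof -
  have "real k ^ m * (\<Prod>i=0..<m. real r + \<epsilon> / real k - real i) * prod_ap k \<epsilon> (r - m) = prod_ap k \<epsilon> r"
    using assms(2)
  proof (induction m)
    case (Suc m)
    have "r - m = Suc (r - Suc m)" using Suc.prems by simp
    then have "prod_ap k \<epsilon> (r - m) = prod_ap k \<epsilon> (r - Suc m) * (real k * (real r - real m) + \<epsilon>)"
      using Suc.prems by (simp add: prod_ap_Suc of_nat_diff)
    also have "real k * (real r - real m) + \<epsilon> = real k * (real r + \<epsilon> / real k - real m)"
      using assms(1) by (simp add: field_simps)
    finally show ?case using Suc.IH Suc.prems by (simp add: mult_ac)
  qed simp
  then show ?thesis by (simp add: gbinomial_mult_fact mult.assoc)
qed

text \<open>This form yields both the integrality of the coefficients and, by Vandermonde, their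
  sum.\<close>

lemma pade_coeff_gbinomial:
  assumes "k \<ge> 2" "i \<le> r"
  shows "pade_coeff k r i =
    real k ^ (2 * r) * ((real r + 1 / real k) gchoose (r - i)) * ((real r - 1 / real k) gchoose i)"
proof -
  define g where "g = (real r + 1 / real k) gchoose (r - i)"
  define g' where "g' = (real r + (-1) / real k) gchoose i"
  have 1: "prod_ap k 1 r = real k ^ (r - i) * fact (r - i) * g * prod_ap k 1 i"
    using gbinomial_prod_ap[of k "r - i" r 1] assms by (simp add: g_def)
  have 2: "prod_ap k (-1) r = real k ^ i * fact i * g' * prod_ap k (-1) (r - i)"
    using gbinomial_prod_ap[of k i r "-1"] assms by (simp add: g'_def)
  have p: "prod_ap k 1 i \<noteq> 0" "prod_ap k (-1) (r - i) \<noteq> 0"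
    using prod_ap_pos[OF assms(1), of 1 i] prod_ap_pos[OF assms(1), of "-1" "r - i"] by auto
  have "real k ^ r = real k ^ (r - i) * real k ^ i" using assms by (simp add: power_add[symmetric])
  then have "real k ^ (2 * r) = real k ^ r * real k ^ (r - i) * real k ^ i"
    by (simp add: mult_2 power_add)
  moreover have "pade_coeff k r i = real k ^ r * real k ^ (r - i) * real k ^ i * g * g'"
    unfolding pade_coeff_def 1 2 using p by (simp add: field_simps)
  ultimately show ?thesis by (simp add: g_def g'_def)
qed

text \<open>One factor \<open>k^m\<close> clears the denominators of the upper index, the other one
  compensates for \<open>m!\<close>.\<close>

lemma power_gbinomial_Ints:
  assumes "k > 0"
  shows "real k ^ (2 * m) * ((real r + real_of_int \<epsilon> / real k) gchoose m) \<in> \<int>"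
proof -
  \<comment> \<open>With this sign, the decreasing factors \<open>k(r - s) + \<epsilon>\<close> of
    the falling factorial are the negatives of an increasing progression
    \<open>x + ks\<close>.\<close>
  define x where "x = - (int k * int r + \<epsilon>)"
  obtain c where c: "int k ^ m * (\<Prod>s<m. x + int k * int s) = fact m * c"
    using fact_dvd_power_mult_prod[OF assms, of m x] by (elim dvdE)
  have "real_of_int (int k ^ m * (\<Prod>s<m. x + int k * int s)) = fact m * real_of_int c"
    unfolding c by simp
  then have c': "real k ^ m * (\<Prod>s<m. real_of_int x + real k * real s) = fact m * real_of_int c"
    by simp
  have "real k ^ (2 * m) * (fact m * ((real r + \<epsilon> / real k) gchoose m))
      = real k ^ m * (real k ^ m * (\<Prod>s=0..<m. real r + \<epsilon> / real k - real s))"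
    by (simp only: gbinomial_mult_fact mult_2 power_add mult.assoc)
  also have "real k ^ m * (\<Prod>s=0..<m. real r + \<epsilon> / real k - real s)
      = (\<Prod>s<m. real k * (real r + \<epsilon> / real k - real s))"
    by (simp add: prod.distrib atLeast0LessThan)
  also have "\<dots> = (\<Prod>s<m. (-1) * (real_of_int x + real k * real s))"
    using assms by (intro prod.cong refl) (simp add: x_def field_simps)
  also have "\<dots> = (-1) ^ m * (\<Prod>s<m. real_of_int x + real k * real s)"
    by (subst prod.distrib) simp
  also have "real k ^ m * \<dots> = (-1) ^ m * (fact m * real_of_int c)"
    using c' by simp
  finally have "fact m * (real k ^ (2 * m) * ((real r + \<epsilon> / real k) gchoose m)) = fact m * ((-1) ^ m * real_of_int c)"
    by (simp add: mult_ac)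
  then have "real k ^ (2 * m) * ((real r + \<epsilon> / real k) gchoose m) = (-1) ^ m * real_of_int c"
    by simp
  then show ?thesis by simp
qed

lemma pade_coeff_Ints:
  assumes "k \<ge> 2" "i \<le> r"
  shows "pade_coeff k r i \<in> \<int>"
proof -
  have "2 * r = 2 * (r - i) + 2 * i" using assms by simp
  then have "real k ^ (2 * r) = real k ^ (2 * (r - i)) * real k ^ (2 * i)" by (metis power_add)
  then have "pade_coeff k r i = (real k ^ (2 * (r - i)) * ((real r + real_of_int 1 / real k) gchoose (r - i)))
      * (real k ^ (2 * i) * ((real r + real_of_int (-1) / real k) gchoose i))"
    using pade_coeff_gbinomial[OF assms] by simp
  also have "\<dots> \<in> \<int>" using assms by (intro Ints_mult power_gbinomial_Ints) auto
  finally show ?thesis .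
qed

lemma pade_coeff_pos: "k \<ge> 2 \<Longrightarrow> pade_coeff k r i > 0"
  unfolding pade_coeff_def using prod_ap_pos[of k 1] prod_ap_pos[of k "-1"]
  by (intro divide_pos_pos mult_pos_pos) auto

text \<open>In the Vandermonde sum the shifts by \<open>1/k\<close> cancel, so the total is
  \<open>k^(2r)\<close> times the central binomial coefficient.\<close>

lemma sum_pade_coeff_le:
  assumes "k \<ge> 2"
  shows "(\<Sum>i\<le>r. pade_coeff k r i) \<le> (4 * real k ^ 2) ^ r"
proof -
  have "(\<Sum>i\<le>r. pade_coeff k r i) = real k ^ (2 * r) *
      (\<Sum>i\<in>{0..r}. ((real r - 1 / real k) gchoose i) * ((real r + 1 / real k) gchoose (r - i)))"
    unfolding sum_distrib_left using assms
    by (intro sum.cong) (auto simp: pade_coeff_gbinomial)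
  also have "\<dots> = real k ^ (2 * r) * ((real r - 1 / real k + (real r + 1 / real k)) gchoose r)"
    by (simp only: gbinomial_Vandermonde)
  also have "real r - 1 / real k + (real r + 1 / real k) = real (2 * r)" by simp
  also have "real (2 * r) gchoose r = real ((2 * r) choose r)" by (simp only: binomial_gbinomial)
  also have "real k ^ (2 * r) * \<dots> \<le> real k ^ (2 * r) * real (2 ^ (2 * r))"
    using binomial_le_pow2[of "2 * r" r] by (intro mult_left_mono) (simp_all only: of_nat_le_iff zero_le_power of_nat_0_le_iff)
  also have "\<dots> = (4 * real k ^ 2) ^ r"
    by (simp add: power_mult power_mult_distrib)
  finally show ?thesis .
qed

definition pade_nodes :: "nat \<Rightarrow> nat \<Rightarrow> nat set" where
  "pade_nodes k r = (\<lambda>i. k * i) ` {..r} \<union> (\<lambda>i. k * i + 1) ` {..r}"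

lemma pade_nodes_disjoint:
  assumes "(k::nat) \<ge> 2"
  shows "(\<lambda>i. k * i) ` {..r} \<inter> (\<lambda>i. k * i + 1) ` {..r} = {}"
proof -
  have "k * i \<noteq> k * j + 1" for i j :: nat
  proof
    assume "k * i = k * j + 1"
    then have "k * (i - j) = 1" by (simp add: diff_mult_distrib2)
    then show False using assms by simp
  qed
  then show ?thesis by blast
qed

lemma card_pade_nodes:
  assumes "k \<ge> 2"
  shows "card (real ` pade_nodes k r) = Suc (2 * r + 1)"
proof -
  have "card (pade_nodes k r) = card ((\<lambda>i. k * i) ` {..r}) + card ((\<lambda>i. k * i + 1) ` {..r})"
    unfolding pade_nodes_def by (intro card_Un_disjoint pade_nodes_disjoint assms) auto
  also have "\<dots> = Suc r + Suc r" using assms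
    by (subst (1 2) card_image) (auto simp: inj_on_def)
  finally show ?thesis by (subst card_image) auto
qed

text \<open>Together with the next lemma this evaluates the Lagrange denominators at the Pade nodes.
  The sign comes from the factors with \<open>j > i\<close>.\<close>

lemma prod_nodes_same:
  assumes "i \<le> r"
  shows "(\<Prod>j\<in>{..r} - {i}. real k * real i - real k * real j) = real k ^ r * fact i * (-1) ^ (r - i) * fact (r - i)"
  using assms
proof (induction r rule: dec_induct)
  case base
  have "{..i} - {i} = {..<i}" by auto
  then have "(\<Prod>j\<in>{..i} - {i}. real k * real i - real k * real j) = (\<Prod>j<i. real k * real (i - j))"
    by (intro prod.cong) (auto simp: of_nat_diff right_diff_distrib)
  also have "\<dots> = (\<Prod>j<i. real k * real (Suc j))"
    by (subst prod.nat_diff_reindex[symmetric]) (auto intro!: prod.cong simp: Suc_diff_Suc)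
  also have "\<dots> = real k ^ i * (\<Prod>j<i. real (Suc j))" by (simp add: prod.distrib del: of_nat_Suc)
  also have "(\<Prod>j<i. real (Suc j)) = fact i"
    by (induction i) (auto simp: mult.commute simp del: of_nat_Suc)
  finally show ?case by simp
next
  case (step r)
  have "{..Suc r} - {i} = insert (Suc r) ({..r} - {i})" using step by auto
  then have "(\<Prod>j\<in>{..Suc r} - {i}. real k * real i - real k * real j)
      = (real k * real i - real k * real (Suc r)) * (real k ^ r * fact i * (-1) ^ (r - i) * fact (r - i))"
    using step by simp
  also have "real k * real i - real k * real (Suc r) = - (real k * real (Suc r - i))"
    using step by (simp add: of_nat_diff algebra_simps)
  also have "Suc r - i = Suc (r - i)" using step by simp
  finally show ?case using \<open>Suc r - i = Suc (r - i)\<close> by (simp add: mult_ac del: of_nat_Suc)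
qed

text \<open>\<open>\<epsilon> = 1\<close> compares the node \<open>ki + 1\<close> with the nodes
  \<open>kj\<close>, and \<open>\<epsilon> = -1\<close> compares \<open>ki\<close> with the nodes
  \<open>kj + 1\<close>. The leading \<epsilon> is the factor \<open>j = i\<close>.\<close>

lemma prod_nodes_other:
  assumes "i \<le> r"
  shows "(\<Prod>j\<le>r. real k * real i + \<epsilon> - real k * real j) = \<epsilon> * prod_ap k \<epsilon> i * (-1) ^ (r - i) * prod_ap k (-\<epsilon>) (r - i)"
  using assms
proof (induction r rule: dec_induct)
  case base
  have "(\<Prod>j\<le>i. real k * real i + \<epsilon> - real k * real j) = (\<Prod>j\<le>i. real k * real (i - j) + \<epsilon>)"
    by (intro prod.cong) (auto simp: of_nat_diff algebra_simps)
  also have "\<dots> = (\<Prod>j<Suc i. real k * real (Suc i - Suc j) + \<epsilon>)"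
    by (simp add: lessThan_Suc_atMost)
  also have "\<dots> = (\<Prod>j<Suc i. real k * real j + \<epsilon>)"
    by (rule prod.nat_diff_reindex)
  also have "\<dots> = \<epsilon> * prod_ap k \<epsilon> i"
    by (induction i) (auto simp: prod_ap_Suc simp del: of_nat_Suc)
  finally show ?case by simp
next
  case (step r)
  have "real k * real i + \<epsilon> - real k * real (Suc r) = - (real k * real (Suc r - i) + -\<epsilon>)"
    using step by (simp add: of_nat_diff algebra_simps)
  moreover have e: "Suc r - i = Suc (r - i)" using step by simp
  ultimately have "real k * real i + \<epsilon> - real k * real (Suc r) = - (real k * real (Suc (r - i)) + -\<epsilon>)"
    by simp
  then show ?case unfolding e prod_ap_Suc prod.atMost_Suc step.IH power_Suc by (simp only:) 
qed

definition pade_form :: "nat \<Rightarrow> nat \<Rightarrow> real \<Rightarrow> real" where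
  "pade_form k r t = (\<Sum>i\<le>r. pade_coeff k r i * t ^ (k * i + 1)) - (\<Sum>i\<le>r. pade_coeff k r (r - i) * t ^ (k * i))"

lemma pade_form_eq_exp_dd:
  assumes "k \<ge> 2" "t > 0"
  shows "pade_form k r t =
    real k ^ (2 * r) * prod_ap k 1 r * prod_ap k (-1) r * exp_dd (real ` pade_nodes k r) (ln t)"
proof -
  define \<kappa> where "\<kappa> = real k ^ (2 * r) * prod_ap k 1 r * prod_ap k (-1) r"
  define w where "w = (\<lambda>e::nat. \<Prod>j\<in>pade_nodes k r - {e}. real e - real j)"
  have k0: "real k \<noteq> 0" using assms by simp
  have nz: "prod_ap k 1 m \<noteq> 0" "prod_ap k (-1) m \<noteq> 0" for m
    using prod_ap_pos[OF assms(1), of 1 m] prod_ap_pos[OF assms(1), of "-1" m] by auto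
  have exp_ln: "exp (real e * ln t) = t ^ e" for e
    using assms by (simp add: exp_of_nat_mult)
  have "exp_dd (real ` pade_nodes k r) (ln t)
      = (\<Sum>e\<in>pade_nodes k r. t ^ e / (\<Prod>j\<in>real ` pade_nodes k r - {real e}. real e - j))"
    unfolding exp_dd_def by (subst sum.reindex) (auto simp: exp_ln)
  also have "\<dots> = (\<Sum>e\<in>pade_nodes k r. t ^ e / w e)"
  proof (intro sum.cong refl arg_cong2[where f = "(/)"])
    fix e
    have "real ` pade_nodes k r - {real e} = real ` (pade_nodes k r - {e})" by auto
    then show "(\<Prod>j\<in>real ` pade_nodes k r - {real e}. real e - j) = w e"
      by (simp add: w_def prod.reindex)
  qed
  also have "\<dots> = (\<Sum>e\<in>(\<lambda>i. k * i) ` {..r}. t ^ e / w e) + (\<Sum>e\<in>(\<lambda>i. k * i + 1) ` {..r}. t ^ e / w e)"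
    unfolding pade_nodes_def by (intro sum.union_disjoint pade_nodes_disjoint assms) auto
  also have "\<dots> = (\<Sum>i\<le>r. t ^ (k * i) / w (k * i)) + (\<Sum>i\<le>r. t ^ (k * i + 1) / w (k * i + 1))"
    using assms by (subst (1 2) sum.reindex) (auto simp: inj_on_def)
  finally have dd: "exp_dd (real ` pade_nodes k r) (ln t) = \<dots>" .
  \<comment> \<open>The signs \<open>(-1)^(r - i)\<close> of the two partial products cancel; the
    remaining minus is the factor \<open>\<epsilon> = -1\<close>.\<close>
  have w0: "\<kappa> / w (k * i) = - pade_coeff k r (r - i)" if i: "i \<le> r" for i
  proof -
    have "pade_nodes k r - {k * i} = (\<lambda>i. k * i) ` ({..r} - {i}) \<union> (\<lambda>i. k * i + 1) ` {..r}"
      using pade_nodes_disjoint[OF assms(1), of r] i assms(1) unfolding pade_nodes_def by auto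
    then have "w (k * i) = (\<Prod>j\<in>(\<lambda>i. k * i) ` ({..r} - {i}). real (k * i) - real j)
        * (\<Prod>j\<in>(\<lambda>i. k * i + 1) ` {..r}. real (k * i) - real j)"
      unfolding w_def using pade_nodes_disjoint[OF assms(1), of r]
      by (simp only:, intro prod.union_disjoint) auto
    also have "\<dots> = (\<Prod>j\<in>{..r} - {i}. real k * real i - real k * real j)
        * (\<Prod>j\<le>r. real k * real i + (-1) - real k * real j)"
      using assms by (subst (1 2) prod.reindex) (auto simp: inj_on_def algebra_simps intro!: prod.cong)
    also have "\<dots> = - (real k ^ r * fact i * fact (r - i) * prod_ap k (-1) i * prod_ap k 1 (r - i))"
      unfolding prod_nodes_same[OF i] prod_nodes_other[OF i] by (simp add: power_add[symmetric] mult_ac)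
    finally show ?thesis unfolding \<kappa>_def pade_coeff_def mult_2 power_add using nz k0 i
      by (simp add: field_simps)
  qed
  have w1: "\<kappa> / w (k * i + 1) = pade_coeff k r i" if i: "i \<le> r" for i
  proof -
    have "pade_nodes k r - {k * i + 1} = (\<lambda>i. k * i) ` {..r} \<union> (\<lambda>i. k * i + 1) ` ({..r} - {i})"
      using pade_nodes_disjoint[OF assms(1), of r] i assms(1) unfolding pade_nodes_def by auto
    then have "w (k * i + 1) = (\<Prod>j\<in>(\<lambda>i. k * i) ` {..r}. real (k * i + 1) - real j)
        * (\<Prod>j\<in>(\<lambda>i. k * i + 1) ` ({..r} - {i}). real (k * i + 1) - real j)"
      unfolding w_def using pade_nodes_disjoint[OF assms(1), of r]
      by (simp only:, intro prod.union_disjoint) auto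
    also have "\<dots> = (\<Prod>j\<le>r. real k * real i + 1 - real k * real j)
        * (\<Prod>j\<in>{..r} - {i}. real k * real i - real k * real j)"
      using assms by (subst (1 2) prod.reindex) (auto simp: inj_on_def algebra_simps intro!: prod.cong)
    also have "\<dots> = real k ^ r * fact i * fact (r - i) * prod_ap k 1 i * prod_ap k (-1) (r - i)"
      unfolding prod_nodes_same[OF i] prod_nodes_other[OF i] by (simp add: power_add[symmetric] mult_ac)
    finally show ?thesis unfolding \<kappa>_def pade_coeff_def mult_2 power_add using nz k0 i
      by (simp add: field_simps)
  qed
  have "\<kappa> * exp_dd (real ` pade_nodes k r) (ln t)
      = (\<Sum>i\<le>r. t ^ (k * i) * (\<kappa> / w (k * i))) + (\<Sum>i\<le>r. t ^ (k * i + 1) * (\<kappa> / w (k * i + 1)))"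
    unfolding dd distrib_left sum_distrib_left by (simp add: mult_ac)
  also have "\<dots> = pade_form k r t"
  proof -
    have "(\<Sum>i\<le>r. t ^ (k * i) * (\<kappa> / w (k * i))) = (\<Sum>i\<le>r. t ^ (k * i) * - pade_coeff k r (r - i))"
      by (intro sum.cong refl) (simp only: w0 atMost_iff)
    moreover have "(\<Sum>i\<le>r. t ^ (k * i + 1) * (\<kappa> / w (k * i + 1))) = (\<Sum>i\<le>r. t ^ (k * i + 1) * pade_coeff k r i)"
      by (intro sum.cong refl) (simp only: w1 atMost_iff)
    ultimately show ?thesis by (simp add: pade_form_def sum_negf mult_ac)
  qed
  finally show ?thesis by (simp add: \<kappa>_def)
qed

section \<open>Size of the approximation error\<close>

lemma four_power_fact_le: "4 ^ r * fact r ^ 2 \<le> (fact (2 * r + 1) :: real)"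
proof (induction r)
  case (Suc r)
  have "4 ^ Suc r * fact (Suc r) ^ 2 = (4 * (real r + 1) ^ 2) * (4 ^ r * fact r ^ 2 :: real)"
    by (simp add: power2_eq_square algebra_simps)
  also have "\<dots> \<le> ((2 * real r + 3) * (2 * real r + 2)) * fact (2 * r + 1)"
    by (rule mult_mono[OF _ Suc.IH]) (simp_all add: power2_eq_square algebra_simps)
  also have "\<dots> = fact (2 * Suc r + 1)" by (simp add: algebra_simps)
  finally show ?case .
qed simp

lemma prod_ap_mult_le: 
  assumes "k \<ge> 2"
  shows "prod_ap k 1 r * prod_ap k (-1) r \<le> real k ^ (2 * r) * fact r ^ 2"
proof (induction r)
  case (Suc r)
  let ?y = "real k * real (Suc r)"
  have "1 * 1 \<le> ?y" using assms by (intro mult_mono) auto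
  then have y: "?y \<ge> 1" by simp
  have "prod_ap k 1 (Suc r) * prod_ap k (-1) (Suc r)
      = (?y ^ 2 - 1) * (prod_ap k 1 r * prod_ap k (-1) r)"
    by (simp add: prod_ap_Suc power2_eq_square algebra_simps)
  also have "\<dots> \<le> ?y ^ 2 * (real k ^ (2 * r) * fact r ^ 2)"
    using prod_ap_pos[OF assms, of 1 r] prod_ap_pos[OF assms, of "-1" r] y
    by (intro mult_mono Suc.IH) auto
  also have "\<dots> = real k ^ (2 * Suc r) * fact (Suc r) ^ 2"
    by (simp add: power_mult_distrib power2_eq_square del: of_nat_Suc)
  finally show ?case .
qed simp

text \<open>The normalising factor is at most \<open>k^(4r) * (r!)^2\<close>, and the divided
  difference contributes \<open>1 / (2r + 1)!\<close>, where
  \<open>4^r * (r!)^2 \<le> (2r + 1)!\<close>. This is the source of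
  \<open>(k^4 / 4)^r\<close>.\<close>

lemma pade_form_bounds:
  assumes "k \<ge> 2" "t \<ge> 1"
  shows "0 \<le> pade_form k r t"
    and "pade_form k r t \<le> (real k ^ 4 / 4) ^ r * ln t ^ (2 * r + 1) * t ^ (k * r + 1)"
proof -
  define \<kappa> where "\<kappa> = real k ^ (2 * r) * (prod_ap k 1 r * prod_ap k (-1) r)"
  have pos: "\<kappa> \<ge> 0" unfolding \<kappa>_def
    using prod_ap_pos[OF assms(1), of 1 r] prod_ap_pos[OF assms(1), of "-1" r] by simp
  have fm: "pade_form k r t = \<kappa> * exp_dd (real ` pade_nodes k r) (ln t)"
    using pade_form_eq_exp_dd[of k t r] assms by (simp add: \<kappa>_def mult.assoc)
  have dd: "0 \<le> exp_dd (real ` pade_nodes k r) (ln t) \<and> exp_dd (real ` pade_nodes k r) (ln t)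
      \<le> ln t ^ (2 * r + 1) / fact (2 * r + 1) * exp (real (k * r + 1) * ln t)"
  proof (rule exp_dd_bounds)
    show "finite (real ` pade_nodes k r)" by (simp add: pade_nodes_def)
    show "card (real ` pade_nodes k r) = Suc (2 * r + 1)" by (rule card_pade_nodes[OF assms(1)])
    show "e \<le> real (k * r + 1)" if "e \<in> real ` pade_nodes k r" for e
    proof -
      have "m \<le> k * r + 1" if "m \<in> pade_nodes k r" for m
        using that unfolding pade_nodes_def by (auto intro: le_SucI)
      then show ?thesis using that by (auto simp only: of_nat_le_iff)
    qed
    show "0 \<le> ln t" using assms by simp
  qed
  show "0 \<le> pade_form k r t" unfolding fm using dd pos by simp
  have e: "exp (real (k * r + 1) * ln t) = t ^ (k * r + 1)"
    using assms by (subst exp_of_nat_mult) simp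
  have "\<kappa> \<le> real k ^ (2 * r) * (real k ^ (2 * r) * fact r ^ 2)"
    unfolding \<kappa>_def by (intro mult_left_mono prod_ap_mult_le assms) auto
  also have "\<dots> = real k ^ (4 * r) * fact r ^ 2" by (simp add: power_add[symmetric])
  also have "\<dots> = (real k ^ 4 / 4) ^ r * (4 ^ r * fact r ^ 2)"
    by (simp add: power_mult power_divide)
  also have "\<dots> \<le> (real k ^ 4 / 4) ^ r * fact (2 * r + 1)"
    by (intro mult_left_mono four_power_fact_le) auto
  finally have kf: "\<kappa> / fact (2 * r + 1) \<le> (real k ^ 4 / 4) ^ r"
    by (simp only: pos_divide_le_eq[OF fact_gt_zero])
  have "pade_form k r t \<le> \<kappa> * (ln t ^ (2 * r + 1) / fact (2 * r + 1) * t ^ (k * r + 1))"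
    unfolding fm using dd pos by (intro mult_left_mono) (simp_all only: e)
  also have "\<dots> = \<kappa> / fact (2 * r + 1) * (ln t ^ (2 * r + 1) * t ^ (k * r + 1))" by simp
  also have "\<dots> \<le> (real k ^ 4 / 4) ^ r * (ln t ^ (2 * r + 1) * t ^ (k * r + 1))"
    using assms by (intro mult_right_mono kf) auto
  finally show "pade_form k r t \<le> (real k ^ 4 / 4) ^ r * ln t ^ (2 * r + 1) * t ^ (k * r + 1)"
    by (simp add: mult.assoc)
qed

text \<open>Letting \<open>x\<close> tend to \<open>a\<close> from the right shows that
  \<open>a\<close> is a root; it is divided out and the argument repeated. One-sided bounds match
  the estimates of \<open>pade_form\<close>, which are made for \<open>t \<ge> 1\<close>.\<close>

lemma poly_dvd_of_bound:
  fixes p :: "real poly"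
  assumes "\<And>x. a < x \<Longrightarrow> x < a + 1 \<Longrightarrow> \<bar>poly p x\<bar> \<le> C * (x - a) ^ m"
  shows "[:- a, 1:] ^ m dvd p"
  using assms
proof (induction m arbitrary: p)
  case (Suc m)
  have "((\<lambda>x. \<bar>poly p x\<bar>) \<longlongrightarrow> \<bar>poly p a\<bar>) (at_right a)"
    by (intro tendsto_intros)
  moreover have "((\<lambda>x. \<bar>poly p x\<bar>) \<longlongrightarrow> 0) (at_right a)"
  proof (rule real_tendsto_sandwich)
    show "eventually (\<lambda>x. 0 \<le> \<bar>poly p x\<bar>) (at_right a)" by simp
    show "eventually (\<lambda>x. \<bar>poly p x\<bar> \<le> C * (x - a) ^ Suc m) (at_right a)"
      unfolding eventually_at_right_field using Suc.prems by (intro exI[of _ "a + 1"]) auto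
    have "((\<lambda>x. C * (x - a) ^ Suc m) \<longlongrightarrow> C * (a - a) ^ Suc m) (at_right a)"
      by (intro tendsto_intros)
    then show "((\<lambda>x. C * (x - a) ^ Suc m) \<longlongrightarrow> 0) (at_right a)" by simp
  qed simp
  ultimately have "\<bar>poly p a\<bar> = 0" by (intro tendsto_unique[of "at_right a"]) auto
  then obtain q where q: "p = [:- a, 1:] * q"
    by (metis abs_eq_0 poly_eq_0_iff_dvd dvd_def)
  have "[:- a, 1:] ^ m dvd q"
  proof (rule Suc.IH)
    fix x assume x: "a < x" "x < a + 1"
    have "(x - a) * \<bar>poly q x\<bar> = \<bar>poly p x\<bar>" using x abs_mult[of "x - a" "poly q x"]
      by (simp add: q left_diff_distrib)
    also have "\<dots> \<le> (x - a) * (C * (x - a) ^ m)" using Suc.prems[OF x] by (simp add: mult_ac)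
    finally show "\<bar>poly q x\<bar> \<le> C * (x - a) ^ m" using x by simp
  qed
  then show ?case unfolding q power_Suc by (intro mult_dvd_mono) auto
qed simp

section \<open>Polynomial form of the approximants and their determinant\<close>

definition pade_num :: "nat \<Rightarrow> nat \<Rightarrow> real poly" where
  "pade_num k r = (\<Sum>i\<le>r. monom (pade_coeff k r i) i)"

definition pade_den :: "nat \<Rightarrow> nat \<Rightarrow> real poly" where
  "pade_den k r = (\<Sum>i\<le>r. monom (pade_coeff k r (r - i)) i)"

lemma poly_pade_num: "poly (pade_num k r) T = (\<Sum>i\<le>r. pade_coeff k r i * T ^ i)"
  by (simp add: pade_num_def poly_sum poly_monom)

lemma poly_pade_den: "poly (pade_den k r) T = (\<Sum>i\<le>r. pade_coeff k r (r - i) * T ^ i)"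
  by (simp add: pade_den_def poly_sum poly_monom)

lemma pade_form_poly:
  "pade_form k r t = t * poly (pade_num k r) (t ^ k) - poly (pade_den k r) (t ^ k)"
  unfolding pade_form_def poly_pade_num poly_pade_den sum_distrib_left power_mult[symmetric]
  by (simp add: mult_ac)

lemma degree_pade_le: "degree (pade_num k r) \<le> r" "degree (pade_den k r) \<le> r"
  unfolding pade_num_def pade_den_def
  by (intro degree_sum_le; force intro: order_trans[OF degree_monom_le])+

text \<open>
  The determinant is a polynomial of degree at most \<open>2r + 1\<close> that vanishes to order \<open>2r + 1\<close> at \<open>1\<close>
  but not at \<open>0\<close>.
\<close>

lemma pade_det_nonzero:
  assumes "k \<ge> 2" "T \<noteq> 1"
  shows "poly (pade_num k r) T * poly (pade_den k (Suc r)) T \<noteq>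
         poly (pade_den k r) T * poly (pade_num k (Suc r)) T"
proof -
  define D where "D = pade_num k r * pade_den k (Suc r) - pade_den k r * pade_num k (Suc r)"
  define M where "M = (\<lambda>p::real poly. SOME C. \<forall>x\<in>{1..2}. \<bar>poly p x\<bar> \<le> C)"
  have M: "\<bar>poly p x\<bar> \<le> M p" if "x \<in> {1..2}" for p x
  proof -
    have "compact (poly p ` {1..2})" by (intro compact_continuous_image continuous_intros) auto
    then obtain C where "\<forall>y\<in>poly p ` {1..2}. norm y \<le> C"
      using compact_imp_bounded bounded_iff by blast
    then have "\<forall>x\<in>{1..2}. \<bar>poly p x\<bar> \<le> C" by auto
    then have "\<forall>x\<in>{1..2}. \<bar>poly p x\<bar> \<le> M p" unfolding M_def by (rule someI)
    then show ?thesis using that by blast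
  qed
  \<comment> \<open>The forms of orders \<open>r\<close> and \<open>r + 1\<close> both vanish at
    least to order \<open>2r + 1\<close>, measured in \<open>t^k - 1\<close> because
    \<open>ln t \<le> t^k - 1\<close>.\<close>
  have F: "\<bar>pade_form k s t\<bar> \<le> (real k ^ 4 / 4) ^ s * 2 ^ (k * s + 1) * (t ^ k - 1) ^ (2 * r + 1)"
    if t: "t > 1" "t ^ k < 2" "s \<ge> r" for s t
  proof -
    have tk: "t \<le> t ^ k" using t assms by (intro self_le_power) auto
    have l: "ln t \<le> t ^ k - 1" using t tk ln_le_minus_one[of t] by linarith
    have "\<bar>pade_form k s t\<bar> = pade_form k s t" using pade_form_bounds(1)[OF assms(1), of t s] t by simp
    also have "\<dots> \<le> (real k ^ 4 / 4) ^ s * ln t ^ (2 * s + 1) * t ^ (k * s + 1)"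
      using t by (intro pade_form_bounds assms) auto
    also have "\<dots> \<le> (real k ^ 4 / 4) ^ s * (t ^ k - 1) ^ (2 * s + 1) * 2 ^ (k * s + 1)"
      using t tk l by (intro mult_mono power_mono mult_nonneg_nonneg zero_le_power) auto
    also have "\<dots> \<le> (real k ^ 4 / 4) ^ s * (t ^ k - 1) ^ (2 * r + 1) * 2 ^ (k * s + 1)"
      using t tk by (intro mult_right_mono mult_left_mono power_decreasing) auto
    finally show ?thesis by (simp add: mult_ac)
  qed
  define C where "C = (real k ^ 4 / 4) ^ r * 2 ^ (k * r + 1) * M (pade_num k (Suc r))
    + (real k ^ 4 / 4) ^ Suc r * 2 ^ (k * Suc r + 1) * M (pade_num k r)"
  have "[:- 1, 1:] ^ (2 * r + 1) dvd D"
  proof (rule poly_dvd_of_bound)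
    fix x :: real assume x: "1 < x" "x < 1 + 1"
    define t where "t = root k x"
    have t: "t ^ k = x" "t > 1" using x assms by (auto simp: t_def)
    have x12: "x \<in> {1..2}" using x by simp
    \<comment> \<open>In this combination of the two forms the terms containing \<open>t\<close>
      itself cancel, so that only polynomials in \<open>t^k\<close> remain.\<close>
    have "poly D x = pade_form k r t * poly (pade_num k (Suc r)) x
        - pade_form k (Suc r) t * poly (pade_num k r) x"
      by (simp add: D_def pade_form_poly t algebra_simps)
    then have "\<bar>poly D x\<bar> \<le> \<bar>pade_form k r t\<bar> * \<bar>poly (pade_num k (Suc r)) x\<bar>
        + \<bar>pade_form k (Suc r) t\<bar> * \<bar>poly (pade_num k r) x\<bar>"
      by (simp add: abs_mult[symmetric])
    also have "\<dots> \<le> ((real k ^ 4 / 4) ^ r * 2 ^ (k * r + 1) * (x - 1) ^ (2 * r + 1)) * M (pade_num k (Suc r))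
        + ((real k ^ 4 / 4) ^ Suc r * 2 ^ (k * Suc r + 1) * (x - 1) ^ (2 * r + 1)) * M (pade_num k r)"
      using F[of t r] F[of t "Suc r"] t x x12
      by (intro add_mono mult_mono M) auto
    also have "\<dots> = C * (x - 1) ^ (2 * r + 1)" by (simp add: C_def algebra_simps)
    finally show "\<bar>poly D x\<bar> \<le> C * (x - 1) ^ (2 * r + 1)" .
  qed
  then obtain E where E: "D = [:- 1, 1:] ^ (2 * r + 1) * E" by (elim dvdE)
  \<comment> \<open>Up to nonzero factors the value at \<open>0\<close> is the difference of
    \<open>k(r + 1) - 1\<close> and \<open>k(r + 1) + 1\<close>, that is \<open>-2\<close>.\<close>
  have D0: "poly D 0 \<noteq> 0"
  proof -
    have n0: "poly (pade_num k r) 0 = pade_coeff k r 0" for r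
      unfolding poly_pade_num by (subst sum.remove[of _ 0]) (auto intro!: sum.neutral)
    have d0: "poly (pade_den k r) 0 = pade_coeff k r r" for r
      unfolding poly_pade_den by (subst sum.remove[of _ 0]) (auto intro!: sum.neutral)
    have nz: "prod_ap k 1 m \<noteq> 0" "prod_ap k (-1) m \<noteq> 0" for m
      using prod_ap_pos[OF assms(1), of 1 m] prod_ap_pos[OF assms(1), of "-1" m] by auto
    have c0: "pade_coeff k r 0 = real k ^ r * prod_ap k 1 r / fact r"
      and cr: "pade_coeff k r r = real k ^ r * prod_ap k (-1) r / fact r" for r
      using nz by (simp_all add: pade_coeff_def)
    have "poly D 0 = real k ^ r * real k ^ Suc r / (fact r * fact (Suc r)) *
        (prod_ap k 1 r * prod_ap k (-1) (Suc r) - prod_ap k (-1) r * prod_ap k 1 (Suc r))"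
      unfolding D_def poly_diff poly_mult n0 d0 c0 cr
      by (simp add: right_diff_distrib diff_divide_distrib mult_ac del: fact_Suc power_Suc)
    also have "prod_ap k 1 r * prod_ap k (-1) (Suc r) - prod_ap k (-1) r * prod_ap k 1 (Suc r)
        = - 2 * prod_ap k 1 r * prod_ap k (-1) r"
      unfolding prod_ap_Suc by (simp add: algebra_simps)
    finally show ?thesis using nz assms by simp
  qed
  then have "D \<noteq> 0" by auto
  then have En: "E \<noteq> 0" using E by auto
  have "degree D \<le> 2 * r + 1"
    unfolding D_def using degree_pade_le[of k r] degree_pade_le[of k "Suc r"]
    by (intro degree_diff_le order_trans[OF degree_mult_le]) auto
  moreover have "degree D = (2 * r + 1) + degree E"
    unfolding E using En
    by (subst degree_mult_eq) (simp_all add: degree_power_eq del: power_Suc power_add)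
  ultimately have "degree E = 0" by simp
  then obtain c where c: "E = [:c:]" by (rule degree_eq_zeroE)
  have "poly D T = (T - 1) ^ (2 * r + 1) * c" unfolding E c by (simp add: algebra_simps)
  moreover have "c \<noteq> 0" using En c by auto
  ultimately have "poly D T \<noteq> 0" using assms by simp
  then show ?thesis by (simp add: D_def)
qed

section \<open>Comparing two solutions\<close>

text \<open>The homogenization of \<open>pade_num\<close>, which takes integer values at integers.
  The coefficients of \<open>pade_den\<close> are those of \<open>pade_num\<close> in reverse order,
  so exchanging \<open>u\<close> and \<open>v\<close> gives the homogenization of
  \<open>pade_den\<close>.\<close>

definition pade_hom :: "nat \<Rightarrow> nat \<Rightarrow> real \<Rightarrow> real \<Rightarrow> real" where
  "pade_hom k r u v = (\<Sum>i\<le>r. pade_coeff k r i * u ^ i * v ^ (r - i))"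

lemma pade_hom_num:
  assumes "v \<noteq> 0"
  shows "pade_hom k r u v = v ^ r * poly (pade_num k r) (u / v)"
  unfolding pade_hom_def poly_pade_num sum_distrib_left
proof (rule sum.cong[OF refl])
  fix i assume "i \<in> {..r}"
  then have "v ^ r = v ^ i * v ^ (r - i)" by (simp add: power_add[symmetric])
  then show "pade_coeff k r i * u ^ i * v ^ (r - i) = v ^ r * (pade_coeff k r i * (u / v) ^ i)"
    using assms by (simp add: power_divide)
qed

lemma pade_hom_den:
  assumes "v \<noteq> 0"
  shows "pade_hom k r v u = v ^ r * poly (pade_den k r) (u / v)"
proof -
  have "pade_hom k r v u = (\<Sum>i\<in>{0..r}. pade_coeff k r i * v ^ i * u ^ (r - i))"
    by (simp add: pade_hom_def atMost_atLeast0)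
  also have "\<dots> = (\<Sum>i\<in>{0..r}. pade_coeff k r (r - i) * v ^ (r - i) * u ^ (r - (r - i)))"
    by (subst sum.atLeastAtMost_rev) simp
  also have "\<dots> = (\<Sum>i\<le>r. v ^ r * (pade_coeff k r (r - i) * (u / v) ^ i))"
  proof (rule sum.cong)
    fix i assume i: "i \<in> {..r}"
    then have "v ^ r = v ^ i * v ^ (r - i)" by (simp add: power_add[symmetric])
    then show "pade_coeff k r (r - i) * v ^ (r - i) * u ^ (r - (r - i))
        = v ^ r * (pade_coeff k r (r - i) * (u / v) ^ i)"
      using assms i by (simp add: power_divide)
  qed auto
  finally show ?thesis by (simp add: poly_pade_den sum_distrib_left)
qed

lemma pade_hom_det_nonzero:
  assumes "k \<ge> 2" "v \<noteq> 0" "u \<noteq> v"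
  shows "pade_hom k r u v * pade_hom k (Suc r) v u \<noteq> pade_hom k r v u * pade_hom k (Suc r) u v"
  using pade_det_nonzero[OF assms(1), of "u / v" r] assms
  by (simp add: pade_hom_num[OF assms(2)] pade_hom_den[OF assms(2)] mult_ac)

lemma pade_hom_Ints:
  assumes "k \<ge> 2" "u \<in> \<int>" "v \<in> \<int>"
  shows "pade_hom k r u v \<in> \<int>"
  unfolding pade_hom_def using assms
  by (intro Ints_sum Ints_mult pade_coeff_Ints Ints_power) auto

lemma pade_hom_le:
  assumes "k \<ge> 2" "0 \<le> u" "0 \<le> v" "u \<le> h" "v \<le> h"
  shows "0 \<le> pade_hom k r u v" "pade_hom k r u v \<le> (4 * real k ^ 2 * h) ^ r"
proof -
  have c: "pade_coeff k r i \<ge> 0" for i using pade_coeff_pos[OF assms(1), of r i] by simp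
  show "0 \<le> pade_hom k r u v" unfolding pade_hom_def
    using assms c by (intro sum_nonneg mult_nonneg_nonneg) auto
  have "pade_hom k r u v \<le> (\<Sum>i\<le>r. pade_coeff k r i * h ^ r)"
    unfolding pade_hom_def
  proof (rule sum_mono)
    fix i assume i: "i \<in> {..r}"
    have "u ^ i * v ^ (r - i) \<le> h ^ i * h ^ (r - i)"
      using assms by (intro mult_mono power_mono) auto
    also have "\<dots> = h ^ r" using i by (simp add: power_add[symmetric])
    finally show "pade_coeff k r i * u ^ i * v ^ (r - i) \<le> pade_coeff k r i * h ^ r"
      using c[of i] by (simp add: mult_left_mono mult.assoc)
  qed
  also have "\<dots> = (\<Sum>i\<le>r. pade_coeff k r i) * h ^ r" by (simp add: sum_distrib_right)
  also have "\<dots> \<le> (4 * real k ^ 2) ^ r * h ^ r"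
    using assms by (intro mult_right_mono sum_pade_coeff_le) auto
  finally show "pade_hom k r u v \<le> (4 * real k ^ 2 * h) ^ r" by (simp add: power_mult_distrib)
qed

text \<open>With \<open>t = X / Y\<close> the remainder is \<open>Y^(kr + 1)\<close> times
  \<open>pade_form k r t\<close>, and \<open>ln t\<close> is at most
  \<open>(X^k - Y^k) / (k * l)\<close>.\<close>

lemma pade_remainder_ordered:
  assumes k: "k \<ge> 2" and l: "0 < l" "l \<le> Y ^ k" and Y: "0 < Y" "Y \<le> X" and h: "X ^ k \<le> h"
  shows "\<bar>X * pade_hom k r (X ^ k) (Y ^ k) - Y * pade_hom k r (Y ^ k) (X ^ k)\<bar>
    \<le> (real k ^ 2 * \<bar>X ^ k - Y ^ k\<bar> ^ 2 * h / (4 * l ^ 2)) ^ r * (\<bar>X ^ k - Y ^ k\<bar> * X / (real k * l))"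
proof -
  define c where "c = X ^ k - Y ^ k"
  have YX: "Y ^ k \<le> X ^ k" using Y by (intro power_mono) auto
  have c0: "c \<ge> 0" using YX by (simp add: c_def)
  define t where "t = X / Y"
  have t1: "t \<ge> 1" using Y by (simp add: t_def)
  have tk: "X ^ k / Y ^ k = t ^ k" by (simp add: t_def power_divide)
  have Yk: "Y ^ k \<noteq> 0" using Y by simp
  have X: "X = t * Y" using Y by (simp add: t_def)
  have eq: "X * pade_hom k r (X ^ k) (Y ^ k) - Y * pade_hom k r (Y ^ k) (X ^ k) = Y * Y ^ (k * r) * pade_form k r t"
    unfolding pade_hom_num[OF Yk] pade_hom_den[OF Yk] tk pade_form_poly power_mult
    by (simp add: X algebra_simps)
  have lnt: "ln t \<le> c / (real k * l)"
  proof -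
    have "real k * ln t = ln (t ^ k)" using t1 by (simp add: ln_realpow)
    also have "\<dots> \<le> t ^ k - 1" using t1 by (intro ln_le_minus_one) auto
    also have "\<dots> = c / Y ^ k" unfolding tk[symmetric] c_def using Y by (simp add: field_simps)
    also have "\<dots> \<le> c / l" using c0 l Y by (intro divide_left_mono) auto
    finally show ?thesis using k l by (simp add: field_simps)
  qed
  have "pade_form k r t \<le> (real k ^ 4 / 4) ^ r * ln t ^ (2 * r + 1) * t ^ (k * r + 1)"
    using t1 by (intro pade_form_bounds k) auto
  also have "\<dots> \<le> (real k ^ 4 / 4) ^ r * (c / (real k * l)) ^ (2 * r + 1) * t ^ (k * r + 1)"
    using t1 lnt by (intro mult_right_mono mult_left_mono power_mono) auto
  finally have "Y * Y ^ (k * r) * pade_form k r t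
      \<le> Y * Y ^ (k * r) * ((real k ^ 4 / 4) ^ r * (c / (real k * l)) ^ (2 * r + 1) * t ^ (k * r + 1))"
    using Y by (intro mult_left_mono) auto
  also have "\<dots> = (real k ^ 4 / 4) ^ r * (c / (real k * l)) ^ (2 * r + 1) * (X ^ (k * r) * X)"
    by (simp add: X power_mult_distrib)
  also have "\<dots> \<le> (real k ^ 4 / 4) ^ r * (c / (real k * l)) ^ (2 * r + 1) * (h ^ r * X)"
    using Y c0 l h by (intro mult_left_mono mult_right_mono mult_nonneg_nonneg zero_le_power divide_nonneg_nonneg)
      (auto simp: power_mult intro!: power_mono)
  also have "\<dots> = ((real k ^ 4 / 4) * (c / (real k * l)) ^ 2 * h) ^ r * (c / (real k * l)) * X"
  proof -
    have "K ^ r * z ^ (2 * r + 1) * (h ^ r * X) = (K * z ^ 2 * h) ^ r * z * X" for K z :: real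
      by (simp add: power_mult power_mult_distrib)
    then show ?thesis .
  qed
  also have "(real k ^ 4 / 4) * (c / (real k * l)) ^ 2 * h = real k ^ 2 * c ^ 2 * h / (4 * l ^ 2)"
    using k l by (simp add: power_divide power_mult_distrib field_simps power4_eq_xxxx power2_eq_square)
  finally have "Y * Y ^ (k * r) * pade_form k r t
      \<le> (real k ^ 2 * c ^ 2 * h / (4 * l ^ 2)) ^ r * (c * X / (real k * l))" by simp
  moreover have "0 \<le> Y * Y ^ (k * r) * pade_form k r t"
    using pade_form_bounds(1)[OF k t1] Y by simp
  ultimately show ?thesis unfolding eq using c0 by (simp add: c_def)
qed

text \<open>Exchanging \<open>X\<close> and \<open>Y\<close> only changes the sign of the remainder,
  which reduces this to the ordered case.\<close>

lemma pade_remainder: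
  assumes k: "k \<ge> 2" and "0 < X" "0 < Y" "0 < l" "l \<le> X ^ k" "l \<le> Y ^ k"
    and h: "X ^ k \<le> h" "Y ^ k \<le> h" and "X \<le> m" "Y \<le> m"
  shows "\<bar>X * pade_hom k r (X ^ k) (Y ^ k) - Y * pade_hom k r (Y ^ k) (X ^ k)\<bar>
    \<le> (real k ^ 2 * \<bar>X ^ k - Y ^ k\<bar> ^ 2 * h / (4 * l ^ 2)) ^ r * (\<bar>X ^ k - Y ^ k\<bar> * m / (real k * l))"
proof -
  have h0: "h \<ge> 0" using h assms by (meson less_imp_le order_trans)
  have mono: "(real k ^ 2 * d ^ 2 * h / (4 * l ^ 2)) ^ r * (d * Z / (real k * l))
      \<le> (real k ^ 2 * d ^ 2 * h / (4 * l ^ 2)) ^ r * (d * m / (real k * l))" if "Z \<le> m" "d \<ge> 0" for Z d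
    using that h0 assms by (intro mult_left_mono divide_right_mono) auto
  show ?thesis
  proof (cases "Y \<le> X")
    case True
    show ?thesis
      using order_trans[OF pade_remainder_ordered[OF k, of l Y X h r] mono[of X]] True assms by auto
  next
    case False
    have s: "\<bar>Y * pade_hom k r (Y ^ k) (X ^ k) - X * pade_hom k r (X ^ k) (Y ^ k)\<bar> =
        \<bar>X * pade_hom k r (X ^ k) (Y ^ k) - Y * pade_hom k r (Y ^ k) (X ^ k)\<bar>"
      "\<bar>Y ^ k - X ^ k\<bar> = \<bar>X ^ k - Y ^ k\<bar>" by (simp_all add: abs_minus_commute)
    show ?thesis
      using order_trans[OF pade_remainder_ordered[OF k, of l X Y h r] mono[of Y "\<bar>Y ^ k - X ^ k\<bar>"]] False assms
      unfolding s by auto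
  qed
qed

text \<open>Each of the \<open>k\<close> terms of \<open>(X^k - Y^k) / (X - Y)\<close> is at least
  \<open>m^(k - 1)\<close>. The bound is written with \<open>m^k\<close>, since \<open>m\<close>
  will be a \<open>k\<close>-th root.\<close>

lemma diff_le_of_power_diff:
  fixes X Y m :: real
  assumes "k > 0" "0 < m" "m \<le> X" "m \<le> Y"
  shows "\<bar>X - Y\<bar> \<le> \<bar>X ^ k - Y ^ k\<bar> * m / (real k * m ^ k)"
proof -
  have mk: "m ^ k = m ^ (k - 1) * m" using assms by (simp add: power_eq_if)
  have "(\<Sum>i<k. m ^ (k - 1)) \<le> (\<Sum>i<k. Y ^ (k - Suc i) * X ^ i)"
  proof (rule sum_mono)
    fix i assume "i \<in> {..<k}"
    then have "k - 1 = (k - Suc i) + i" by auto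
    then have "m ^ (k - 1) = m ^ (k - Suc i) * m ^ i" by (metis power_add)
    also have "\<dots> \<le> Y ^ (k - Suc i) * X ^ i" using assms by (intro mult_mono power_mono) auto
    finally show "m ^ (k - 1) \<le> Y ^ (k - Suc i) * X ^ i" .
  qed
  then have s: "real k * m ^ (k - 1) \<le> (\<Sum>i<k. Y ^ (k - Suc i) * X ^ i)" by simp
  have "\<bar>X - Y\<bar> * (real k * m ^ (k - 1)) \<le> \<bar>X - Y\<bar> * (\<Sum>i<k. Y ^ (k - Suc i) * X ^ i)"
    by (intro mult_left_mono s) auto
  also have "\<dots> = \<bar>X ^ k - Y ^ k\<bar>"
    unfolding power_diff_sumr2[of X k Y] abs_mult
    using assms by (subst abs_of_nonneg[of "sum _ _"]) (auto intro!: sum_nonneg)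
  finally show ?thesis using assms unfolding mk by (simp add: field_simps)
qed

lemma root_scale_le:
  assumes "k > 0" "c \<ge> 1" "D \<ge> 0"
  shows "root k (c * D) \<le> c * root k D"
proof -
  have "root k c \<le> root k (c ^ k)" using assms by (simp add: self_le_power)
  also have "\<dots> = c" using assms by (simp add: real_root_power_cancel)
  finally have "root k c \<le> c" .
  then show ?thesis using assms by (simp add: real_root_mult mult_right_mono)
qed

text \<open>The difference \<Delta> of the two sides is an integer. Scaled by
  \<open>g = root k (a * a')\<close> it splits into two parts. The first is small by condition
  \<open>I\<close>, because \<open>X1\<close> and \<open>Y1\<close> are close; the second is the
  Pade remainder at \<open>b0\<close>, small by condition \<open>II\<close>. Each part is below
  \<open>g / 2\<close>, so \<open>\<Delta> = 0\<close>.\<close>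

lemma pade_determinant_vanishes:
  fixes k a a' b0 b1 x0 y0 x1 y1 r :: nat and n :: int
  assumes k: "k \<ge> 3" and n0: "n \<noteq> 0" and aa: "0 < a" "a < a'" and bb: "0 < b0" "b0 < b1"
    and x0: "real x0 ^ k = real a * real b0 + of_int n" and y0: "real y0 ^ k = real a' * real b0 + of_int n"
    and x1: "real x1 ^ k = real a * real b1 + of_int n" and y1: "real y1 ^ k = real a' * real b1 + of_int n"
    and large: "16 * \<bar>real_of_int n\<bar> \<le> real a * real b0"
    and Z: "Z = root k (real a * real a' * real b0 * real b1)"
    and I: "\<bar>real_of_int n\<bar> * Z * (5 * real k ^ 2 * real a * real a' * real b0) ^ r \<le> real a * real b1"
    and II: "\<bar>real_of_int n\<bar> * Z \<le> real a * real b0 * (real a * real b0 / (real k ^ 2 * real_of_int n ^ 2 * real a')) ^ r"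
    and u: "u = real a' * real x0 ^ k" and v: "v = real a * real y0 ^ k"
  shows "real x1 * real y0 * pade_hom k r v u = real y1 * real x0 * pade_hom k r u v"
proof -
  define \<nu> where "\<nu> = \<bar>real_of_int n\<bar>"
  have \<nu>: "\<nu> > 0" using n0 by (simp add: \<nu>_def)
  have k0: "k > 0" and k2: "k \<ge> 2" using k by auto
  define D where "D = real a * real a' * real b0"
  define D1 where "D1 = real a * real a' * real b1"
  have D: "D > 0" "D1 > 0" "D \<le> D1" using aa bb by (auto simp: D_def D1_def)
  have small: "16 * (\<nu> * real a') \<le> D" "16 * (\<nu> * real a') \<le> D1"
  proof -
    have "(16 * \<nu>) * real a' \<le> (real a * real b0) * real a'"
      using large aa unfolding \<nu>_def by (intro mult_right_mono) auto
    then show "16 * (\<nu> * real a') \<le> D" by (simp add: D_def mult_ac)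
    then show "16 * (\<nu> * real a') \<le> D1" using D by simp
  qed
  have na: "\<bar>real_of_int n * real a'\<bar> \<le> \<nu> * real a'" "\<bar>real_of_int n * real a\<bar> \<le> \<nu> * real a'"
    using aa by (auto simp: \<nu>_def abs_mult intro!: mult_left_mono)
  define u1 where "u1 = real a' * real x1 ^ k"
  define v1 where "v1 = real a * real y1 ^ k"
  have uv: "u = D + of_int n * real a'" "v = D + of_int n * real a"
    "u1 = D1 + of_int n * real a'" "v1 = D1 + of_int n * real a"
    unfolding u v u1_def v1_def x0 y0 x1 y1 D_def D1_def by (simp_all add: algebra_simps)
  \<comment> \<open>By \<open>large\<close>, the shifts \<open>n * a\<close> and
    \<open>n * a'\<close> are at most one sixteenth of \<open>D\<close> and of \<open>D1\<close>.
    All the factors \<open>15/16\<close> and \<open>17/16\<close> below come from here.\<close>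
  have bnd: "15/16 * D \<le> u" "u \<le> 17/16 * D" "15/16 * D \<le> v" "v \<le> 17/16 * D"
    "15/16 * D1 \<le> u1" "u1 \<le> 17/16 * D1" "15/16 * D1 \<le> v1" "v1 \<le> 17/16 * D1"
    using na small unfolding uv by (auto simp: abs_le_iff)
  define c where "c = \<bar>u - v\<bar>"
  have c1: "\<bar>u1 - v1\<bar> = c" by (simp add: c_def uv)
  have ca: "c \<le> \<nu> * real a'"
  proof -
    have "c = \<bar>real_of_int n * (real a' - real a)\<bar>" by (simp add: c_def uv algebra_simps)
    also have "\<dots> = \<nu> * (real a' - real a)" using aa by (simp add: abs_mult \<nu>_def)
    also have "\<dots> \<le> \<nu> * real a'" using \<nu> by (intro mult_left_mono) auto
    finally show ?thesis .
  qed
  have c0: "c \<ge> 0" by (simp add: c_def)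
  define X where "X = root k u" define Y where "Y = root k v"
  define X1 where "X1 = root k u1" define Y1 where "Y1 = root k v1"
  define g where "g = root k (real a * real a')"
  have pos: "u > 0" "v > 0" "u1 > 0" "v1 > 0" using bnd D by linarith+
  have pos': "X > 0" "Y > 0" "X1 > 0" "Y1 > 0" "g > 0"
    using pos k0 aa by (simp_all add: X_def Y_def X1_def Y1_def g_def)
  have pw: "X ^ k = u" "Y ^ k = v" "X1 ^ k = u1" "Y1 ^ k = v1"
    using pos k0 by (simp_all add: X_def Y_def X1_def Y1_def)
  have ra: "root k (real p * real q ^ k) = root k (real p) * real q" for p q
    using k0 by (simp add: real_root_mult real_root_power_cancel)
  \<comment> \<open>The single roots need not be rational, but these mixed products are integers up
    to the common factor \<open>g\<close>.\<close>
  have X1Y: "X1 * Y = g * (real x1 * real y0)" and Y1X: "Y1 * X = g * (real y1 * real x0)"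
    unfolding X_def Y_def X1_def Y1_def g_def u v u1_def v1_def ra by (simp_all add: real_root_mult)
  define \<Delta> where "\<Delta> = real x1 * real y0 * pade_hom k r v u - real y1 * real x0 * pade_hom k r u v"
  define R where "R = X * pade_hom k r u v - Y * pade_hom k r v u"
  \<comment> \<open>The coefficient \<open>4 * 17/16\<close> is rounded up to
    \<open>5\<close>.\<close>
  define H where "H = 5 * real k ^ 2 * D"
  have gD: "g * \<Delta> = (X1 - Y1) * (Y * pade_hom k r v u) - Y1 * R"
  proof -
    have "g * \<Delta> = (X1 * Y) * pade_hom k r v u - (Y1 * X) * pade_hom k r u v"
      unfolding X1Y Y1X \<Delta>_def by (simp add: algebra_simps)
    then show ?thesis by (simp add: R_def algebra_simps)
  qed
  define d where "d = root k D" define d1 where "d1 = root k D1"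
  have d: "d > 0" "d1 > 0" using D k0 by (simp_all add: d_def d1_def)
  have XY: "X \<le> 17/16 * d" "Y \<le> 17/16 * d" "Y1 \<le> 17/16 * d1"
  proof -
    have "root k w \<le> 17/16 * root k e" if "w \<le> 17/16 * e" "e \<ge> 0" for w e
      using that k0 by (intro order_trans[OF real_root_le_mono root_scale_le]) auto
    then show "X \<le> 17/16 * d" "Y \<le> 17/16 * d" "Y1 \<le> 17/16 * d1"
      unfolding X_def Y_def Y1_def d_def d1_def using bnd D by auto
  qed
  have q: "0 \<le> pade_hom k r v u" "pade_hom k r v u \<le> H ^ r"
  proof -
    show "0 \<le> pade_hom k r v u" using pade_hom_le(1)[OF k2, of v u "17/16 * D"] pos bnd by simp
    have "pade_hom k r v u \<le> (4 * real k ^ 2 * (17/16 * D)) ^ r"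
      using pos bnd by (intro pade_hom_le k2) auto
    also have "\<dots> \<le> H ^ r" unfolding H_def using D by (intro power_mono) auto
    finally show "pade_hom k r v u \<le> H ^ r" .
  qed
  have dX: "\<bar>X1 - Y1\<bar> \<le> c * d1 * (16/15) / (real k * D1)"
  proof -
    define m where "m = root k (15/16 * D1)"
    have m: "m > 0" "m ^ k = 15/16 * D1" "m \<le> X1" "m \<le> Y1" "m \<le> d1"
      using D k0 bnd by (auto simp: m_def X1_def Y1_def d1_def)
    have "\<bar>X1 - Y1\<bar> \<le> \<bar>X1 ^ k - Y1 ^ k\<bar> * m / (real k * m ^ k)"
      using m k0 by (intro diff_le_of_power_diff) auto
    also have "\<dots> = c * m / (real k * (15/16 * D1))" by (simp only: pw c1 m)
    also have "\<dots> \<le> c * d1 / (real k * (15/16 * D1))"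
      using m c0 D by (intro divide_right_mono mult_left_mono) auto
    finally show ?thesis by (simp add: field_simps)
  qed
  have Rb: "\<bar>R\<bar> \<le> (real k ^ 2 * c ^ 2 / D) ^ r * (c * d * (17/15) / (real k * D))"
  proof -
    have "\<bar>R\<bar> \<le> (real k ^ 2 * c ^ 2 * (17/16 * D) / (4 * (15/16 * D) ^ 2)) ^ r * (c * (17/16 * d) / (real k * (15/16 * D)))"
      using pade_remainder[OF k2, of X Y "15/16 * D" "17/16 * D" "17/16 * d" r] pos' D bnd XY
      by (simp only: pw R_def c_def)
    also have "\<dots> \<le> (real k ^ 2 * c ^ 2 / D) ^ r * (c * (17/16 * d) / (real k * (15/16 * D)))"
    proof (intro mult_right_mono power_mono)
      have "real k ^ 2 * c ^ 2 * (17/16 * D) / (4 * (15/16 * D) ^ 2) = (real k ^ 2 * c ^ 2 / D) * (17/16 / (4 * (15/16)^2))"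
        using D by (simp add: field_simps power2_eq_square)
      also have "\<dots> \<le> (real k ^ 2 * c ^ 2 / D) * 1"
        using D by (intro mult_left_mono) (auto simp: power2_eq_square)
      finally show "real k ^ 2 * c ^ 2 * (17/16 * D) / (4 * (15/16 * D) ^ 2) \<le> real k ^ 2 * c ^ 2 / D" by simp
    qed (use D c0 d in auto)
    finally show ?thesis by (simp add: field_simps)
  qed
  define E where "E = real a * real b0 / (real k ^ 2 * real_of_int n ^ 2 * real a')"
  have E0: "E > 0" using aa bb k n0 by (simp add: E_def)
  have cE: "real k ^ 2 * c ^ 2 / D \<le> 1 / E"
  proof -
    have "real k ^ 2 * c ^ 2 / D \<le> real k ^ 2 * (\<nu> * real a') ^ 2 / D"
      using ca c0 D by (intro divide_right_mono mult_left_mono power_mono) auto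
    also have "\<dots> = 1 / E" using aa bb
      by (simp add: E_def D_def \<nu>_def power_mult_distrib field_simps power2_eq_square)
    finally show ?thesis .
  qed
  have gZ: "d * d1 = g * Z"
    unfolding d_def d1_def g_def Z D_def D1_def real_root_mult[symmetric] by (simp add: mult_ac)
  have Z0: "Z > 0" using k0 aa bb by (simp add: Z)
  have "\<bar>(X1 - Y1) * (Y * pade_hom k r v u)\<bar> \<le> (c * d1 * (16/15) / (real k * D1)) * (17/16 * d * H ^ r)"
    unfolding abs_mult using dX XY q pos' c0 d D
    by (intro mult_mono) (auto intro!: mult_mono)
  also have "\<dots> = c * (d * d1) * (17/15) / real k * (H ^ r / D1)" by (simp add: field_simps)
  also have "\<dots> \<le> (\<nu> * real a') * (d * d1) * (17/15) / 3 * (H ^ r / D1)"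
    using ca c0 d D k by (intro mult_mono frac_le) (auto simp: H_def)
  also have "\<dots> = g * (17/45) * (\<nu> * Z * H ^ r / (real a * real b1))"
    unfolding gZ using aa by (simp add: D1_def field_simps)
  also have "\<dots> \<le> g * (17/45) * 1"
    using I pos' aa bb by (intro mult_left_mono) (auto simp: H_def D_def \<nu>_def mult_ac divide_le_eq)
  finally have t1: "\<bar>(X1 - Y1) * (Y * pade_hom k r v u)\<bar> \<le> g * (17/45)" by simp
  have "\<bar>Y1 * R\<bar> \<le> (17/16 * d1) * ((real k ^ 2 * c ^ 2 / D) ^ r * (c * d * (17/15) / (real k * D)))"
    unfolding abs_mult using Rb XY pos' d by (intro mult_mono) auto
  also have "\<dots> \<le> (17/16 * d1) * ((1 / E) ^ r * ((\<nu> * real a') * d * (17/15) / (3 * D)))"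
  proof (rule mult_left_mono[OF mult_mono])
    show "(real k ^ 2 * c ^ 2 / D) ^ r \<le> (1 / E) ^ r" using cE D by (intro power_mono) auto
    show "c * d * (17/15) / (real k * D) \<le> (\<nu> * real a') * d * (17/15) / (3 * D)"
      using ca c0 d D k \<nu> by (intro frac_le mult_right_mono) auto
  qed (use d D c0 E0 in auto)
  also have "\<dots> = (d * d1) * (289/720) * (\<nu> * (1 / E) ^ r / (real a * real b0))"
    using aa by (simp add: D_def field_simps)
  also have "\<dots> = g * (289/720) * (\<nu> * Z / (real a * real b0 * E ^ r))"
    unfolding gZ by (simp add: field_simps power_divide)
  also have "\<dots> \<le> g * (289/720) * 1"
    using II pos' aa bb E0 by (intro mult_left_mono) (auto simp: E_def[symmetric] \<nu>_def divide_le_eq)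
  finally have t2: "\<bar>Y1 * R\<bar> \<le> g * (289/720)" by simp
  \<comment> \<open>Here \<open>17/45\<close> is \<open>(17/16) * (16/15) / 3\<close> and
    \<open>289/720\<close> is that times \<open>17/16\<close>; the \<open>3\<close> is the lower
    bound for \<open>k\<close>, and the two fractions add up to less than \<open>1\<close>.\<close>
  have "g * \<bar>\<Delta>\<bar> = \<bar>g * \<Delta>\<bar>" using pos' by (simp add: abs_mult)
  also have "\<dots> \<le> g * (17/45) + g * (289/720)" unfolding gD using t1 t2 by linarith
  also have "\<dots> < g * 1" using pos' by simp
  finally have "\<bar>\<Delta>\<bar> < 1" using pos' by simp
  moreover have "\<Delta> \<in> \<int>"
    unfolding \<Delta>_def u v by (intro Ints_diff Ints_mult pade_hom_Ints k2 Ints_power) auto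
  ultimately have "\<Delta> = 0" by (rule Ints_nonzero_abs_less1[rotated])
  then show ?thesis by (simp add: \<Delta>_def)
qed

text \<open>If the integer of the previous lemma vanishes for both orders \<open>r\<close> and
  \<open>r + 1\<close>, then so does the determinant of two consecutive approximants, which is
  impossible. Condition \<open>I\<close> is required at order \<open>r + 1\<close> and
  \<open>II\<close> at order \<open>r\<close>; as \<open>H\<close> and \<open>E\<close> are at least
  \<open>1\<close>, both then hold at both orders.\<close>

lemma two_solutions_contradiction:
  fixes k a a' b0 b1 x0 y0 x1 y1 r :: nat and n :: int
  assumes k: "k \<ge> 3" and n0: "n \<noteq> 0" and aa: "0 < a" "a < a'" and bb: "0 < b0" "b0 < b1"
    and x0: "real x0 ^ k = real a * real b0 + of_int n" and y0: "real y0 ^ k = real a' * real b0 + of_int n"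
    and x1: "real x1 ^ k = real a * real b1 + of_int n" and y1: "real y1 ^ k = real a' * real b1 + of_int n"
    and pos: "x0 > 0" "y0 > 0" "x1 > 0" "y1 > 0"
    and large: "16 * \<bar>real_of_int n\<bar> \<le> real a * real b0"
    and Z: "Z = root k (real a * real a' * real b0 * real b1)"
    and H: "H = 5 * real k ^ 2 * real a * real a' * real b0"
    and E: "E = real a * real b0 / (real k ^ 2 * real_of_int n ^ 2 * real a')" "E \<ge> 1"
    and I: "\<bar>real_of_int n\<bar> * Z * H ^ Suc r \<le> real a * real b1"
    and II: "\<bar>real_of_int n\<bar> * Z \<le> real a * real b0 * E ^ r"
  shows False
proof -
  define u v where "u = real a' * real x0 ^ k" and "v = real a * real y0 ^ k"
  have k2: "k \<ge> 2" using k by simp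
  have Z0: "Z \<ge> 0" unfolding Z by (intro real_root_ge_zero) auto
  have "1 * 1 * 1 * 1 * 1 \<le> H" unfolding H using k aa bb by (intro mult_mono) (auto intro!: order_trans[OF _ one_le_power])
  then have H1: "H \<ge> 1" by simp
  have "H ^ r \<le> H ^ Suc r" using H1 by (intro power_increasing) auto
  then have I': "\<bar>real_of_int n\<bar> * Z * H ^ r \<le> real a * real b1"
    using Z0 by (intro order_trans[OF _ I] mult_left_mono) auto
  have "E ^ r \<le> E ^ Suc r" using E by (intro power_increasing) auto
  then have II': "\<bar>real_of_int n\<bar> * Z \<le> real a * real b0 * E ^ Suc r"
    by (intro order_trans[OF II] mult_left_mono) auto
  note van = pade_determinant_vanishes[OF k n0 aa bb x0 y0 x1 y1 large Z, folded H E(1), OF _ _ u_def v_def]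
  have e1: "real x1 * real y0 * pade_hom k r v u = real y1 * real x0 * pade_hom k r u v"
    by (rule van[OF I' II])
  have e2: "real x1 * real y0 * pade_hom k (Suc r) v u = real y1 * real x0 * pade_hom k (Suc r) u v"
    by (rule van[OF I II'])
  have "(real x1 * real y0 * real y1 * real x0) * (pade_hom k r u v * pade_hom k (Suc r) v u)
      = (real x1 * real y0 * pade_hom k (Suc r) v u) * (real y1 * real x0 * pade_hom k r u v)"
    by (simp add: mult_ac)
  also have "\<dots> = (real y1 * real x0 * pade_hom k (Suc r) u v) * (real x1 * real y0 * pade_hom k r v u)"
    by (simp only: e1 e2)
  also have "\<dots> = (real x1 * real y0 * real y1 * real x0) * (pade_hom k r v u * pade_hom k (Suc r) u v)"
    by (simp add: mult_ac)
  finally have "pade_hom k r u v * pade_hom k (Suc r) v u = pade_hom k r v u * pade_hom k (Suc r) u v"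
    using pos by simp
  moreover have "v \<noteq> 0" using pos aa by (simp add: v_def)
  moreover have "u \<noteq> v"
  proof -
    have "u - v = of_int n * (real a' - real a)" unfolding u_def v_def x0 y0 by (simp add: algebra_simps)
    also have "\<dots> \<noteq> 0" using n0 aa by simp
    finally show ?thesis by simp
  qed
  ultimately show False using pade_hom_det_nonzero[OF k2] by blast
qed

section \<open>The gap principle and the logarithmic form of the comparison\<close>

definition shifted_power :: "nat \<Rightarrow> int \<Rightarrow> nat \<Rightarrow> nat \<Rightarrow> bool" where
  "shifted_power k n a b \<longleftrightarrow> 0 < a \<and> 0 < b \<and> (\<exists>x::nat. x \<ge> 1 \<and> int a * int b + n = int x ^ k)"

lemma shifted_power_commute: "shifted_power k n a b \<longleftrightarrow> shifted_power k n b a"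
  by (auto simp: shifted_power_def mult.commute)

lemma shifted_powerE:
  assumes "shifted_power k n a b"
  obtains x :: nat where "x > 0" "real x ^ k = real a * real b + of_int n"
proof -
  from assms obtain x :: nat where x: "x \<ge> 1" "int a * int b + n = int x ^ k"
    by (auto simp: shifted_power_def)
  have "real_of_int (int a * int b + n) = real_of_int (int x ^ k)" by (simp only: x)
  then have "real x ^ k = real a * real b + of_int n" by simp
  with x show ?thesis by (intro that[of x]) auto
qed

text \<open>The integers \<open>x' * y\<close> and \<open>x * y'\<close> are distinct, hence at
  least \<open>1\<close> apart, while their \<open>k\<close>-th powers differ by
  \<open>\<bar>n\<bar> (a' - a)(b' - b)\<close> and are both at least
  \<open>9/16 * a a' b b'\<close>. Dividing the difference of the powers by the derivative of the
  power gives an inequality whose \<open>k\<close>-th power, in logarithms, is the claim.\<close>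

lemma gap_principle:
  fixes k a a' b b' :: nat and n :: int
  assumes k: "k \<ge> 3" and n0: "n \<noteq> 0" and ab: "a < a'" "b < b'"
    and pw: "shifted_power k n a b" "shifted_power k n a b'" "shifted_power k n a' b" "shifted_power k n a' b'"
    and large: "4 * \<bar>real_of_int n\<bar> \<le> real a * real b"
  shows "(real k - 1) * (ln a + ln b) \<le> real k * ln \<bar>real_of_int n\<bar> + ln a' + ln b'"
proof -
  obtain x where x: "x > 0" "real x ^ k = real a * real b + of_int n" using shifted_powerE[OF pw(1)] .
  obtain x' where x': "x' > 0" "real x' ^ k = real a * real b' + of_int n" using shifted_powerE[OF pw(2)] .
  obtain y where y: "y > 0" "real y ^ k = real a' * real b + of_int n" using shifted_powerE[OF pw(3)] .
  obtain y' where y': "y' > 0" "real y' ^ k = real a' * real b' + of_int n" using shifted_powerE[OF pw(4)] .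
  have pos: "0 < a" "0 < b" "0 < a'" "0 < b'" using pw by (auto simp: shifted_power_def)
  have k0: "k > 0" using k by simp
  define p where "p = real (x' * y)" define q where "q = real (x * y')"
  have pk: "p ^ k = (real a * real b' + of_int n) * (real a' * real b + of_int n)"
    by (simp add: p_def power_mult_distrib x' y)
  have qk: "q ^ k = (real a * real b + of_int n) * (real a' * real b' + of_int n)"
    by (simp add: q_def power_mult_distrib x y')
  have diff: "p ^ k - q ^ k = - of_int n * ((real a' - real a) * (real b' - real b))"
    unfolding pk qk by (simp add: algebra_simps)
  have "p ^ k - q ^ k \<noteq> 0" unfolding diff using n0 ab by simp
  then have "x' * y \<noteq> x * y'" unfolding p_def q_def by (metis diff_self)
  then have "\<bar>int (x' * y) - int (x * y')\<bar> \<ge> 1" by linarith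
  then have "\<bar>real_of_int (int (x' * y) - int (x * y'))\<bar> \<ge> 1" by linarith
  then have pq: "\<bar>p - q\<bar> \<ge> 1" by (simp add: p_def q_def)
  define W where "W = real a * real a' * real b * real b'"
  have W: "W > 0" using pos by (simp add: W_def)
  define m where "m = root k (9/16 * W)"
  have m: "m > 0" "m ^ k = 9/16 * W" using W k0 by (auto simp: m_def)
  have lo: "3/4 * (real c * real d) \<le> real c * real d + of_int n" if "a \<le> c" "b \<le> d" for c d
  proof -
    have "real a * real b \<le> real c * real d" using that by (intro mult_mono) auto
    then have "4 * \<bar>real_of_int n\<bar> \<le> real c * real d" using large by simp
    then show ?thesis by (simp add: abs_le_iff)
  qed
  have "(3/4 * (real a * real b')) * (3/4 * (real a' * real b)) \<le> p ^ k"
    unfolding pk using ab by (intro mult_mono lo order_trans[OF _ lo]) auto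
  then have mp: "m ^ k \<le> p ^ k" by (simp add: m W_def mult_ac)
  have "(3/4 * (real a * real b)) * (3/4 * (real a' * real b')) \<le> q ^ k"
    unfolding qk using ab by (intro mult_mono lo order_trans[OF _ lo]) auto
  then have mq: "m ^ k \<le> q ^ k" by (simp add: m W_def mult_ac)
  have "p \<ge> 0" "q \<ge> 0" by (simp_all add: p_def q_def)
  then have mpq: "m \<le> p" "m \<le> q" using mp mq m(1) k0 by (auto simp: power_mono_iff)
  have "1 \<le> \<bar>p ^ k - q ^ k\<bar> * m / (real k * m ^ k)"
    using order_trans[OF pq diff_le_of_power_diff[OF k0 m(1) mpq]] .
  also have "\<dots> \<le> (\<bar>real_of_int n\<bar> * (real a' * real b')) * m / (real k * m ^ k)"
  proof (intro divide_right_mono mult_right_mono)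
    have "\<bar>p ^ k - q ^ k\<bar> = \<bar>real_of_int n\<bar> * ((real a' - real a) * (real b' - real b))"
      unfolding diff using ab by (simp add: abs_mult)
    also have "\<dots> \<le> \<bar>real_of_int n\<bar> * (real a' * real b')"
      using ab by (intro mult_left_mono mult_mono) auto
    finally show "\<bar>p ^ k - q ^ k\<bar> \<le> \<bar>real_of_int n\<bar> * (real a' * real b')" .
  qed (use m in auto)
  finally have "real k * m ^ k \<le> \<bar>real_of_int n\<bar> * (real a' * real b') * m"
    using m(1) k0 by (simp add: field_simps)
  then have "ln (real k * m ^ k) \<le> ln (\<bar>real_of_int n\<bar> * (real a' * real b') * m)"
    using m(1) k0 n0 pos by (subst ln_le_cancel_iff) auto
  then have L: "ln k + real k * ln m \<le> ln \<bar>real_of_int n\<bar> + (ln a' + ln b') + ln m"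
    using m(1) k0 n0 pos by (simp add: ln_mult ln_realpow)
  have lm: "real k * ln m = ln (9/16) + (ln a + ln a' + ln b + ln b')"
  proof -
    have "real k * ln m = ln (m ^ k)" using m(1) by (simp add: ln_realpow)
    also have "\<dots> = ln (9/16) + ln W" unfolding m(2) using W by (subst ln_mult) auto
    also have "ln W = ln a + ln a' + ln b + ln b'" unfolding W_def using pos by (simp add: ln_mult)
    finally show ?thesis .
  qed
  \<comment> \<open>As \<open>k \<ge> 3\<close> exceeds \<open>16/9\<close>, the factor
    \<open>k\<close> from the derivative absorbs the loss \<open>9/16\<close>.\<close>
  have kk: "ln (real k) \<ge> - ln (9/16 :: real)"
  proof -
    have "- ln (9/16 :: real) = ln (16/9)" using ln_inverse[of "9/16::real"] by simp
    also have "\<dots> \<le> ln (real k)" using k by (subst ln_le_cancel_iff) auto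
    finally show ?thesis .
  qed
  have "real k * (ln k + real k * ln m) \<le> real k * (ln \<bar>real_of_int n\<bar> + (ln a' + ln b') + ln m)"
    using L by (intro mult_left_mono) auto
  then have "real k * ln k + real k * (real k * ln m) \<le> real k * (ln \<bar>real_of_int n\<bar> + (ln a' + ln b')) + real k * ln m"
    by (simp add: algebra_simps)
  then have "real k * ln k + (real k - 1) * (ln (9/16) + (ln a + ln a' + ln b + ln b'))
      \<le> real k * (ln \<bar>real_of_int n\<bar> + (ln a' + ln b'))"
    unfolding lm by (simp add: algebra_simps)
  moreover have "0 \<le> real k * ln k + (real k - 1) * ln (9/16)"
  proof -
    have "(real k - 1) * (- ln (9/16)) \<le> (real k - 1) * ln k" using k kk by (intro mult_left_mono) auto
    moreover have "0 \<le> ln (real k)" using k by simp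
    ultimately show ?thesis by (simp add: algebra_simps)
  qed
  ultimately show ?thesis by (simp add: algebra_simps)
qed

text \<open>Here \<open>e\<close>, \<open>h\<close> and \<open>w\<close> are the logarithms of
  \<open>E\<close>, \<open>H\<close> and \<open>Z\<close>; the conditions become linear in the
  logarithms of the solutions.\<close>

lemma two_solutions_log:
  fixes k a a' b0 b1 r :: nat and n :: int
  assumes k: "k \<ge> 3" and n0: "n \<noteq> 0" and ab: "a < a'" "b0 < b1"
    and pw: "shifted_power k n a b0" "shifted_power k n a b1" "shifted_power k n a' b0" "shifted_power k n a' b1"
    and \<mu>: "\<mu> = ln \<bar>real_of_int n\<bar>"
    and large: "ln 16 + \<mu> \<le> ln a + ln b0"
    and e: "e = ln a + ln b0 - ln a' - 2 * \<mu> - 2 * ln k" "e \<ge> 0"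
    and h: "h = ln 5 + 2 * ln k + ln a + ln a' + ln b0"
    and w: "real k * w = ln a + ln a' + ln b0 + ln b1"
    and I: "\<mu> + w + (real r + 1) * h \<le> ln a + ln b1"
    and II: "\<mu> + w \<le> ln a + ln b0 + real r * e"
  shows False
proof -
  obtain x0 where x0: "x0 > 0" "real x0 ^ k = real a * real b0 + of_int n" using shifted_powerE[OF pw(1)] .
  obtain x1 where x1: "x1 > 0" "real x1 ^ k = real a * real b1 + of_int n" using shifted_powerE[OF pw(2)] .
  obtain y0 where y0: "y0 > 0" "real y0 ^ k = real a' * real b0 + of_int n" using shifted_powerE[OF pw(3)] .
  obtain y1 where y1: "y1 > 0" "real y1 ^ k = real a' * real b1 + of_int n" using shifted_powerE[OF pw(4)] .
  have pos: "0 < a" "0 < a'" "0 < b0" "0 < b1" "0 < k" using pw k by (auto simp: shifted_power_def)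
  have np: "\<bar>real_of_int n\<bar> > 0" using n0 by simp
  define H where "H = 5 * real k ^ 2 * real a * real a' * real b0"
  define E where "E = real a * real b0 / (real k ^ 2 * real_of_int n ^ 2 * real a')"
  define Z where "Z = root k (real a * real a' * real b0 * real b1)"
  have HEZ: "H > 0" "E > 0" "Z > 0" using pos n0 by (auto simp: H_def E_def Z_def)
  have lnH: "ln H = h" using pos by (simp add: H_def h ln_mult ln_realpow)
  define \<nu> where "\<nu> = \<bar>real_of_int n\<bar>"
  have \<nu>: "\<nu> > 0" "\<mu> = ln \<nu>" using np by (simp_all add: \<nu>_def \<mu>)
  have "E = real a * real b0 / (real k ^ 2 * \<nu> ^ 2 * real a')" by (simp add: E_def \<nu>_def)
  then have lnE: "ln E = e" using pos \<nu>(1) by (simp add: e \<nu>(2) ln_mult ln_div ln_realpow)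
  have lnZ: "ln Z = w"
  proof -
    have "ln Z = (ln a + ln a' + ln b0 + ln b1) / real k"
      using pos by (simp add: Z_def ln_root ln_mult)
    then show ?thesis unfolding w[symmetric] using pos by simp
  qed
  show False
  proof (rule two_solutions_contradiction[OF k n0 pos(1) ab(1) pos(3) ab(2) x0(2) y0(2) x1(2) y1(2)
        x0(1) y0(1) x1(1) y1(1) _ Z_def H_def E_def])
    have "ln (16 * \<bar>real_of_int n\<bar>) \<le> ln (real a * real b0)"
      using large pos np by (simp add: ln_mult \<mu>)
    then show "16 * \<bar>real_of_int n\<bar> \<le> real a * real b0"
      using pos np by (subst (asm) ln_le_cancel_iff) auto
    have "ln 1 \<le> ln E" using e lnE by simp
    then show "1 \<le> E" using HEZ by (subst (asm) ln_le_cancel_iff) auto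
    have "ln (\<bar>real_of_int n\<bar> * Z * H ^ Suc r) \<le> ln (real a * real b1)"
      using I pos np HEZ by (simp add: ln_mult ln_realpow lnH lnZ \<mu> algebra_simps del: power_Suc)
    then show "\<bar>real_of_int n\<bar> * Z * H ^ Suc r \<le> real a * real b1"
      using pos np HEZ by (subst (asm) ln_le_cancel_iff) auto
    have "ln (\<bar>real_of_int n\<bar> * Z) \<le> ln (real a * real b0 * E ^ r)"
      using II pos np HEZ by (simp add: ln_mult ln_realpow lnE lnZ \<mu>)
    then show "\<bar>real_of_int n\<bar> * Z \<le> real a * real b0 * E ^ r"
      using pos np HEZ by (subst (asm) ln_le_cancel_iff) auto
  qed
qed

text \<open>
  The order \<open>r\<close> of the approximant is the least one satisfying the second condition of
  \<open>two_solutions_log\<close>; minimality yields the lower bound for \<open>b\<^sub>1\<close> in its first condition.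
\<close>

lemma no_far_solution:
  fixes k a a' b0 b1 r0 :: nat and n :: int
  assumes k: "k \<ge> 3" and n0: "n \<noteq> 0" and ab: "a < a'" "b0 < b1"
    and pw: "shifted_power k n a b0" "shifted_power k n a b1" "shifted_power k n a' b0" "shifted_power k n a' b1"
    and \<mu>: "\<mu> = ln \<bar>real_of_int n\<bar>"
    and \<sigma>: "\<sigma> = ln a + ln b0" and large: "ln 16 + \<mu> \<le> \<sigma>"
    and e: "e = \<sigma> - ln a' - 2 * \<mu> - 2 * ln k"
    and h: "h = ln 5 + 2 * ln k + ln a' + \<sigma>"
    and slope: "h \<le> (real k - 1) * e"
    and base: "real k * \<mu> + ln a' + (real r0 + 1) * h \<le> (real k - 2) * \<sigma> + (real k - 1) * ((real r0 - 1) * e)"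
    and far: "real k * (\<sigma> + (real r0 - 1) * e) < real k * \<mu> + ln a' + \<sigma> + ln b1"
  shows False
proof -
  have pos: "0 < a" "0 < a'" "0 < b0" "0 < b1" "0 < k" using pw k by (auto simp: shifted_power_def)
  have lpos: "ln a \<ge> 0" "ln a' \<ge> 0" "ln b0 \<ge> 0" "ln (real k) \<ge> 0" using pos by auto
  have "h > 0" using lpos by (simp add: h \<sigma> add_pos_nonneg add_nonneg_nonneg)
  then have "(real k - 1) * e > 0" using slope by simp
  then have e0: "e > 0" using k by (simp add: zero_less_mult_iff)
  define w where "w = (ln a + ln a' + ln b0 + ln b1) / real k"
  have w: "real k * w = ln a + ln a' + ln b0 + ln b1" using pos by (simp add: w_def)
  have far': "\<sigma> + (real r0 - 1) * e < \<mu> + w"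
  proof -
    have "real k * (\<sigma> + (real r0 - 1) * e) < real k * (\<mu> + w)"
      using far w by (simp add: \<sigma> distrib_left)
    then show ?thesis using pos by simp
  qed
  define P where "P = (\<lambda>r::nat. \<mu> + w \<le> \<sigma> + real r * e)"
  have "\<exists>r. P r"
  proof -
    obtain r :: nat where "(\<mu> + w - \<sigma>) / e \<le> real r" using real_arch_simple by blast
    then show ?thesis unfolding P_def using e0 by (intro exI[of _ r]) (simp add: field_simps)
  qed
  define r where "r = (LEAST r. P r)"
  have Pr: "P r" unfolding r_def by (rule LeastI_ex) fact
  \<comment> \<open>The hypothesis \<open>far\<close> says that the second condition fails at order
    \<open>r0 - 1\<close>, and so at every smaller order.\<close>
  have rr0: "r \<ge> r0"
  proof (rule ccontr)
    assume "\<not> r \<ge> r0"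
    then have "real r \<le> real r0 - 1" by linarith
    then have "real r * e \<le> (real r0 - 1) * e" using e0 by (intro mult_right_mono) auto
    then show False using Pr far' by (simp add: P_def)
  qed
  have fail: "\<sigma> + (real r - 1) * e < \<mu> + w"
  proof (cases r)
    case 0
    then show ?thesis using rr0 far' by simp
  next
    case (Suc r')
    then have "\<not> P r'" unfolding r_def using not_less_Least by (metis lessI)
    then show ?thesis by (simp add: P_def Suc)
  qed
  \<comment> \<open>\<open>base\<close> is this condition at order \<open>r0\<close> with
    \<open>w\<close> replaced by its lower bound. Raising the order by one raises the two sides by
    \<open>h\<close> and \<open>(k - 1) * e\<close>, which \<open>slope\<close> compares.\<close>
  have I: "\<mu> + w + (real r + 1) * h \<le> ln a + ln b1"
  proof -
    have "(real k - 1) * (\<sigma> + (real r - 1) * e - \<mu>) \<le> (real k - 1) * w"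
      using fail k by (intro mult_left_mono) auto
    moreover have "0 \<le> (real r - real r0) * ((real k - 1) * e - h)"
      using rr0 slope by (intro mult_nonneg_nonneg) auto
    ultimately show ?thesis using base w lpos(1) unfolding \<sigma>[symmetric]
      by (simp add: algebra_simps \<sigma>)
  qed
  show False
    using two_solutions_log[OF k n0 ab pw \<mu> _ _ _ _ w I] large e0 Pr e h \<sigma>
    by (simp add: P_def)
qed

text \<open>Each bound compares integer powers, such as \<open>3^5 \<le> 2^8\<close>, and inserts
  the known bounds for \<open>ln 2\<close>.\<close>

lemma ln_numeral_bounds:
  "ln (2::real) \<ge> 2/3" "ln (2::real) \<le> 25/36" "ln (3::real) \<le> 10/9" "ln (5::real) \<le> 175/108"
  "ln (7::real) \<ge> 28/15" "ln (15::real) \<ge> 13/5"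
proof -
  show l2: "ln (2::real) \<ge> 2/3" by (rule ln2_ge_two_thirds)
  show u2: "ln (2::real) \<le> 25/36" by (rule ln2_le_25_over_36)
  have cmp: "real p * ln x \<le> real q * ln y" if "x ^ p \<le> y ^ q" "x > 0" "y > 0" for x y :: real and p q
    using that ln_le_cancel_iff[of "x ^ p" "y ^ q"] by (simp add: ln_realpow)
  show "ln (3::real) \<le> 10/9" using cmp[of 3 5 2 8] u2 by simp
  show "ln (5::real) \<le> 175/108" using cmp[of 5 3 2 7] u2 by simp
  show "ln (7::real) \<ge> 28/15" using cmp[of 2 14 7 5] l2 by simp
  show "ln (15::real) \<ge> 13/5" using cmp[of 2 39 15 10] l2 by simp
qed

lemma ln_4_6_16: "ln (4::real) = 2 * ln 2" "ln (6::real) = ln 2 + ln 3" "ln (16::real) = 4 * ln 2"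
  using ln_realpow[of "2::real" 2] ln_realpow[of "2::real" 4] ln_mult[of "2::real" 3] by simp_all

text \<open>Two gaps raise \<open>ln b''\<close> to about \<open>(k - 1)^2 * \<sigma>\<close>, and
  \<open>no_far_solution\<close> with \<open>r0 = 2\<close> asks for more than about
  \<open>(2k - 1) * \<sigma>\<close>. The difference \<open>k^2 - 4k + 2\<close> of these
  coefficients is positive for \<open>k \<ge> 4\<close> but not for \<open>k = 3\<close>.\<close>

lemma far_after_two_gaps:
  fixes k a a' b b' b'' :: nat and n :: int
  assumes k: "k \<ge> 4" and n0: "n \<noteq> 0" and a: "a < a'" and b: "b < b'" "b' < b''"
    and pw: "\<And>x. x \<in> {b, b', b''} \<Longrightarrow> shifted_power k n a x \<and> shifted_power k n a' x"
    and \<mu>: "\<mu> = ln \<bar>real_of_int n\<bar>" and \<sigma>: "\<sigma> = ln a + ln b"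
    and large: "ln 16 + \<mu> \<le> \<sigma>"
    and slope: "real k * ln a' + 2 * (real k - 1) * \<mu> + 2 * real k * ln k + ln 5 \<le> (real k - 2) * \<sigma>"
    and base: "(real k + 3) * ln a' + (3 * real k - 2) * \<mu> + 2 * (real k + 2) * ln k + 3 * ln 5 \<le> (2 * real k - 6) * \<sigma>"
    and far: "real k ^ 2 * \<mu> \<le> (real k ^ 2 - 4 * real k + 2) * \<sigma>"
  shows False
proof -
  have k3: "k \<ge> 3" using k by simp
  have pos: "0 < a" "0 < b" "0 < b'" using pw[of b] pw[of b'] by (auto simp: shifted_power_def)
  have np: "\<bar>real_of_int n\<bar> > 0" using n0 by simp
  have ln16: "16 * \<bar>real_of_int n\<bar> \<le> real a * real b"
  proof -
    have "ln (16 * \<bar>real_of_int n\<bar>) \<le> ln (real a * real b)"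
      using large pos np by (simp add: ln_mult \<mu> \<sigma>)
    then show ?thesis using pos np by (subst (asm) ln_le_cancel_iff) auto
  qed
  have "real a * real b \<le> real a * real b'" using b by (intro mult_left_mono) auto
  then have l4: "4 * \<bar>real_of_int n\<bar> \<le> real a * real b" "4 * \<bar>real_of_int n\<bar> \<le> real a * real b'"
    using ln16 np by linarith+
  have g1: "(real k - 1) * \<sigma> \<le> real k * \<mu> + ln a' + ln b'"
    unfolding \<sigma> \<mu> using pw by (intro gap_principle k3 n0 a b l4) auto
  have g2: "(real k - 1) * (ln a + ln b') \<le> real k * \<mu> + ln a' + ln b''"
    unfolding \<mu> using pw by (intro gap_principle k3 n0 a b l4) auto
  define e where "e = \<sigma> - ln a' - 2 * \<mu> - 2 * ln k"
  define h where "h = ln 5 + 2 * ln k + ln a' + \<sigma>"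
  have la: "ln (real a) \<ge> 0" "ln (real k) > 0" using pos k by auto
  show False
  proof (rule no_far_solution[OF k3 n0 a _ _ _ _ _ \<mu> \<sigma> large e_def h_def, of b'' 2])
    show "b < b''" using b by simp
    show "h \<le> (real k - 1) * e" using slope by (simp add: e_def h_def algebra_simps)
    show "real k * \<mu> + ln a' + (real 2 + 1) * h \<le> (real k - 2) * \<sigma> + (real k - 1) * ((real 2 - 1) * e)"
      using base by (simp add: e_def h_def algebra_simps)
    have "(real k - 1) * ((real k - 1) * \<sigma> - real k * \<mu> - ln a' + ln a) \<le> (real k - 1) * (ln a + ln b')"
      using g1 k by (intro mult_left_mono) auto
    then have "(real k - 1) * ((real k - 1) * \<sigma> - real k * \<mu> - ln a' + ln a) \<le> real k * \<mu> + ln a' + ln b''"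
      using g2 by linarith
    moreover have "real k * ln (real a) \<ge> ln a" "real k * ln (real k) > 0"
      using la k by (auto simp: mult_le_cancel_right1)
    moreover have "ln (real a') \<ge> 0" "real k * \<mu> \<ge> 0" using a n0 by (auto simp: \<mu>)
    ultimately show "real k * (\<sigma> + (real 2 - 1) * e) < real k * \<mu> + ln a' + \<sigma> + ln b''"
      using far by (simp add: e_def algebra_simps power2_eq_square)
  qed (use pw in auto)
qed

section \<open>Growth along a grid of solutions\<close>

text \<open>The bounds at \<open>(0, 1)\<close> and \<open>(1, 0)\<close> open every cell except
  \<open>(0, 0)\<close> to the gap principle. The corner is exempt because for
  \<open>\<bar>n\<bar> = 1\<close> the power there may be \<open>1\<close>.\<close>

definition power_grid :: "nat \<Rightarrow> int \<Rightarrow> nat \<Rightarrow> (nat \<Rightarrow> nat) \<Rightarrow> (nat \<Rightarrow> nat) \<Rightarrow> bool" where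
  "power_grid k n N a b \<longleftrightarrow>
     strict_mono_on {..<N} a \<and> strict_mono_on {..<N} b \<and>
     (\<forall>i<N. \<forall>j<N. shifted_power k n (a i) (b j)) \<and>
     4 * \<bar>real_of_int n\<bar> \<le> real (a 0) * real (b 1) \<and> 4 * \<bar>real_of_int n\<bar> \<le> real (a 1) * real (b 0)"

lemma power_grid_commute: "power_grid k n N a b \<Longrightarrow> power_grid k n N b a"
  by (simp add: power_grid_def shifted_power_commute mult.commute)

lemma power_grid_less:
  assumes "power_grid k n N a b" "i < j" "j < N"
  shows "a i < a j" "b i < b j"
  using assms by (auto simp: power_grid_def strict_mono_on_def)

lemma power_grid_shifted_power: "power_grid k n N a b \<Longrightarrow> i < N \<Longrightarrow> j < N \<Longrightarrow> shifted_power k n (a i) (b j)"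
  by (simp add: power_grid_def)

lemma power_grid_pos:
  assumes "power_grid k n N a b" "i < N"
  shows "a i > 0" "b i > 0"
  using power_grid_shifted_power[OF assms(1) assms(2) assms(2)] by (auto simp: shifted_power_def)

lemma power_grid_gap:
  assumes g: "power_grid k n N a b" and k: "k \<ge> 3" and n0: "n \<noteq> 0"
    and i: "i < i'" "i' < N" and j: "j < j'" "j' < N" "j > 0"
  shows "(real k - 1) * (ln (a i) + ln (b j)) \<le> real k * ln \<bar>real_of_int n\<bar> + ln (a i') + ln (b j')"
proof (rule gap_principle[OF k n0])
  have "a 0 \<le> a i" using power_grid_less(1)[OF g, of 0 i] i by (cases "i = 0") auto
  moreover have "b 1 \<le> b j" using power_grid_less(2)[OF g, of 1 j] j by (cases "j = 1") auto
  ultimately have "real (a 0) * real (b 1) \<le> real (a i) * real (b j)" by (intro mult_mono) auto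
  then show "4 * \<bar>real_of_int n\<bar> \<le> real (a i) * real (b j)" using g by (simp add: power_grid_def)
qed (use i j power_grid_less[OF g] power_grid_shifted_power[OF g] in auto)

section \<open>Exponents \<open>k \<ge> 4\<close>\<close>

lemma ln_le_linear: "k \<ge> 6 \<Longrightarrow> ln (real k) \<le> real k / 6 + 5/6"
proof -
  assume k: "k \<ge> 6"
  have "ln (real k) = ln 6 + ln (real k / 6)" using k by (simp add: ln_div)
  \<comment> \<open>This is the tangent of the logarithm at \<open>6\<close>; the constant
    \<open>5/6\<close> in the claim exceeds \<open>ln 6 - 1\<close>.\<close>
  also have "ln (real k / 6) \<le> real k / 6 - 1" using k by (intro ln_le_minus_one) auto
  finally show ?thesis using ln_numeral_bounds ln_4_6_16 by simp
qed

text \<open>Since \<open>a 1 \<le> b 1\<close>, also \<open>ln (a 1) \<le> s\<close>, so each gap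
  multiplies \<open>\<sigma> j\<close> by \<open>k - 1\<close> up to a loss \<open>c\<close> of at
  most \<open>k * \<mu> + s\<close>. From \<open>\<sigma> 1 = s\<close> this grows until columns
  \<open>j\<close>, \<open>j + 1\<close>, \<open>j + 2\<close> contradict
  \<open>far_after_two_gaps\<close>. The values \<open>j = 5, 4, 3\<close> for \<open>k = 4\<close>,
  \<open>k = 5\<close>, \<open>k \<ge> 6\<close> explain \<open>N = j + 3\<close>.\<close>

lemma no_power_grid_ge_4:
  fixes k :: nat and n :: int
  assumes g: "power_grid k n N a b" and k: "k \<ge> 4" and n0: "n \<noteq> 0" and ab: "a 1 \<le> b 1"
    and N: "N = (if k = 4 then 8 else if k = 5 then 7 else 6)"
    and s: "s = ln (a 0) + ln (b 1)" "s \<ge> 5/2"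
    and \<mu>: "\<mu> = ln \<bar>real_of_int n\<bar>" "2 * (real k + 1) * \<mu> \<le> (real k - 2) * s"
  shows False
proof -
  have k3: "k \<ge> 3" using k by simp
  have N2: "N \<ge> 6" using N by auto
  define \<sigma> where "\<sigma> = (\<lambda>j. ln (real (a 0)) + ln (real (b j)))"
  define c where "c = real k * \<mu> + ln (a 1) - ln (a 0)"
  have p0: "0 < a 0" "0 < a 1" "0 < b 1" using power_grid_pos[OF g] N2 by auto
  have \<mu>0: "\<mu> \<ge> 0" using n0 by (auto simp: \<mu>)
  have la: "ln (real (a 0)) \<ge> 0" "ln (real (a 1)) \<ge> 0" using p0 by auto
  have l1: "ln (real (a 1)) \<le> s"
  proof -
    have "ln (real (a 1)) \<le> ln (real (b 1))" using ab p0 by simp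
    then show ?thesis using s(1) la by simp
  qed
  have step: "(real k - 1) * \<sigma> j - c \<le> \<sigma> (Suc j)" if "j > 0" "Suc j < N" for j
    using power_grid_gap[OF g k3 n0, of 0 1 j "Suc j"] that N2 by (simp add: \<sigma>_def c_def \<mu>)
  have s1: "\<sigma> 1 = s" by (simp add: \<sigma>_def s)
  have core: False if j: "j > 0" "j + 2 < N" and
    hyps: "ln 16 + \<mu> \<le> \<sigma> j"
     "real k * ln (a 1) + 2 * (real k - 1) * \<mu> + 2 * real k * ln k + ln 5 \<le> (real k - 2) * \<sigma> j"
     "(real k + 3) * ln (a 1) + (3 * real k - 2) * \<mu> + 2 * (real k + 2) * ln k + 3 * ln 5 \<le> (2 * real k - 6) * \<sigma> j"
     "real k ^ 2 * \<mu> \<le> (real k ^ 2 - 4 * real k + 2) * \<sigma> j" for j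
  proof (rule far_after_two_gaps[OF k n0 _ _ _ _ \<mu>(1) _ hyps])
    show "a 0 < a 1" "b j < b (j + 1)" "b (j + 1) < b (j + 2)"
      using power_grid_less[OF g] j by auto
    show "shifted_power k n (a 0) x \<and> shifted_power k n (a 1) x" if "x \<in> {b j, b (j + 1), b (j + 2)}" for x
      using that power_grid_shifted_power[OF g] j by auto
  qed (simp add: \<sigma>_def)
  note lnb = ln_numeral_bounds ln_4_6_16
  consider "k = 4" | "k = 5" | "k \<ge> 6" using k by linarith
  then show False
  proof cases
    case 1
    have st: "3 * \<sigma> 1 - c \<le> \<sigma> 2" "3 * \<sigma> 2 - c \<le> \<sigma> 3" "3 * \<sigma> 3 - c \<le> \<sigma> 4" "3 * \<sigma> 4 - c \<le> \<sigma> 5"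
      using step[of 1] step[of 2] step[of 3] step[of 4] 1 N by (simp_all add: numeral_eq_Suc)
    have \<mu>s: "10 * \<mu> \<le> 2 * s" using \<mu>(2) 1 by simp
    have c': "c = 4 * \<mu> + ln (a 1) - ln (a 0)" by (simp add: c_def 1)
    \<comment> \<open>Four gaps give \<open>81 * s - 40 * c\<close>, where \<open>c\<close> is at
      most \<open>9/5 * s\<close>.\<close>
    have "9 * s \<le> \<sigma> 5" using st s1 \<mu>s c' la l1 by linarith
    then show False using \<mu>s \<mu>0 la l1 s(2) lnb
      by (intro core[of 5]) (simp_all add: 1 N)
  next
    case 2
    have st: "4 * \<sigma> 1 - c \<le> \<sigma> 2" "4 * \<sigma> 2 - c \<le> \<sigma> 3" "4 * \<sigma> 3 - c \<le> \<sigma> 4"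
      using step[of 1] step[of 2] step[of 3] 2 N by (simp_all add: numeral_eq_Suc)
    have \<mu>s: "12 * \<mu> \<le> 3 * s" using \<mu>(2) 2 by simp
    have c': "c = 5 * \<mu> + ln (a 1) - ln (a 0)" by (simp add: c_def 2)
    \<comment> \<open>Three gaps give \<open>64 * s - 21 * c\<close>, where \<open>c\<close> is at
      most \<open>9/4 * s\<close>.\<close>
    have "16 * s \<le> \<sigma> 4" using st s1 \<mu>s c' la l1 by linarith
    then show False using \<mu>s \<mu>0 la l1 s(2) lnb
      by (intro core[of 4]) (simp_all add: 2 N)
  next
    case 3
    obtain m where m: "k = m + 6" using 3 by (metis add.commute le_Suc_ex)
    define x where "x = real m"
    have kx: "real k = x + 6" "x \<ge> 0" by (simp_all add: m x_def)
    have st: "(x + 5) * \<sigma> 1 - c \<le> \<sigma> 2" "(x + 5) * \<sigma> 2 - c \<le> \<sigma> 3"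
      using step[of 1] step[of 2] 3 N by (simp_all add: kx add.commute[of x] numeral_eq_Suc)
    have \<mu>s: "2 * (x + 7) * \<mu> \<le> (x + 4) * s" using \<mu>(2) by (simp add: kx algebra_simps)
    have \<mu>s1: "2 * ((x + 6) * \<mu>) \<le> (x + 4) * s" using \<mu>s \<mu>0 by (simp add: algebra_simps)
    have \<mu>s2: "2 * \<mu> \<le> s"
    proof -
      have "(x + 4) * (2 * \<mu>) \<le> (x + 4) * s" using \<mu>s \<mu>0 kx by (simp add: algebra_simps)
      then show ?thesis using kx by simp
    qed
    have c': "c \<le> (x + 4) / 2 * s + s" using \<mu>s1 la l1 by (simp add: c_def kx)
    have "(x + 5) * ((x + 5) * s - c) \<le> (x + 5) * \<sigma> 2" using st s1 kx by (intro mult_left_mono) auto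
    then have "(x + 5) * ((x + 5) * s) - (x + 6) * c \<le> \<sigma> 3" using st(2) by (simp add: algebra_simps)
    moreover have "(x + 6) * c \<le> (x + 6) * ((x + 4) / 2 * s + s)" using c' kx by (intro mult_left_mono) auto
    ultimately have "(x + 5) * ((x + 5) * s) - (x + 6) * ((x + 4) / 2 * s + s) \<le> \<sigma> 3" by linarith
    moreover have "(x + 5) * ((x + 5) * s) - (x + 6) * ((x + 4) / 2 * s + s) = (x ^ 2 / 2 + 4 * x + 7) * s"
      by (simp add: field_simps power2_eq_square)
    ultimately have \<sigma>3: "(x ^ 2 / 2 + 4 * x + 7) * s \<le> \<sigma> 3" by simp
    \<comment> \<open>The conditions are now polynomial inequalities in \<open>x = k - 6\<close>.
      Linear arithmetic treats the monomials as atoms, so each needed product with a power of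
      \<open>x\<close> is supplied separately.\<close>
    have xs: "x * s \<ge> x * (5/2)" "x ^ 2 * s \<ge> x ^ 2 * (5/2)" "x ^ 3 * s \<ge> x ^ 3 * (5/2)"
      by (rule mult_left_mono[OF s(2)], simp add: kx)+
    have x0: "x \<ge> 0" "x ^ 2 \<ge> 0" "x ^ 3 \<ge> 0" using kx by auto
    define y where "y = ln (real k)"
    have lk: "y \<le> x / 6 + 11/6" using ln_le_linear[OF 3] unfolding y_def by (simp add: kx(1) add_divide_distrib)
    have \<mu>x: "x * \<mu> \<le> x * (s / 2)" using \<mu>s2 kx by (intro mult_left_mono) auto
    have l1x: "x * ln (a 1) \<le> x * s" using l1 kx by (intro mult_left_mono) auto
    have lkx: "x * y \<le> x * (x / 6 + 11/6)" using lk kx by (intro mult_left_mono) auto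
    have \<sigma>3x: "x * ((x ^ 2 / 2 + 4 * x + 7) * s) \<le> x * \<sigma> 3" using \<sigma>3 kx by (intro mult_left_mono) auto
    have \<mu>xx: "x ^ 2 * \<mu> \<le> x ^ 2 * (s / 2)" using \<mu>s2 kx by (intro mult_left_mono) auto
    have \<sigma>s: "7 * s \<le> \<sigma> 3" "s \<le> \<sigma> 3" "x * s \<le> x * \<sigma> 3" "x ^ 2 * s \<le> x ^ 2 * \<sigma> 3"
    proof -
      have "7 * s \<le> (x ^ 2 / 2 + 4 * x + 7) * s" using x0 s(2) by (intro mult_right_mono) auto
      then show "7 * s \<le> \<sigma> 3" using \<sigma>3 by simp
      then show *: "s \<le> \<sigma> 3" using s(2) by simp
      show "x * s \<le> x * \<sigma> 3" "x ^ 2 * s \<le> x ^ 2 * \<sigma> 3" using * x0 by (auto intro: mult_left_mono)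
    qed
    define A where "A = ln (real (a 1))"
    define S where "S = \<sigma> 3"
    have A: "A \<le> s" "x * A \<le> x * s" using l1 l1x by (simp_all add: A_def)
    have S: "x ^ 2 * s / 2 + 4 * (x * s) + 7 * s \<le> S"
      "x ^ 3 * s / 2 + 4 * (x ^ 2 * s) + 7 * (x * s) \<le> x * S"
      using \<sigma>3 \<sigma>3x by (simp_all add: S_def algebra_simps power2_eq_square power3_eq_cube)
    have Y: "x * y \<le> x ^ 2 / 6 + 11/6 * x" using lkx by (simp add: algebra_simps power2_eq_square)
    have \<mu>': "x * \<mu> \<le> (x * s) / 2" "x ^ 2 * \<mu> \<le> (x ^ 2 * s) / 2" using \<mu>x \<mu>xx by simp_all
    have sl: "x * A + 6 * A + 2 * (x * \<mu>) + 10 * \<mu> + 2 * (x * y) + 12 * y + ln 5 \<le> x * S + 4 * S"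
      using A S Y \<mu>' \<mu>s2 lk xs x0 s(2) lnb(4) by linarith
    have ba: "x * A + 9 * A + 3 * (x * \<mu>) + 16 * \<mu> + 2 * (x * y) + 16 * y + 3 * ln 5 \<le> 2 * (x * S) + 6 * S"
      using A S Y \<mu>' \<mu>s2 lk xs x0 s(2) lnb(4) by linarith
    have fa: "x ^ 2 * \<mu> + 12 * (x * \<mu>) + 36 * \<mu> \<le> x ^ 2 * S + 8 * (x * S) + 14 * S"
      using \<mu>' \<mu>s2 \<sigma>s xs x0 s(2) unfolding S_def[symmetric] by linarith
    show False
    proof (rule core[of 3])
      show "ln 16 + \<mu> \<le> \<sigma> 3"
        using \<sigma>s(1) s(2) \<mu>s2 lnb by linarith
      show "real k * ln (a 1) + 2 * (real k - 1) * \<mu> + 2 * real k * ln k + ln 5 \<le> (real k - 2) * \<sigma> 3"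
        unfolding y_def[symmetric] A_def[symmetric] S_def[symmetric] unfolding kx(1)
        using sl by (simp add: algebra_simps)
      show "(real k + 3) * ln (a 1) + (3 * real k - 2) * \<mu> + 2 * (real k + 2) * ln k + 3 * ln 5 \<le> (2 * real k - 6) * \<sigma> 3"
        unfolding y_def[symmetric] A_def[symmetric] S_def[symmetric] unfolding kx(1)
        using ba by (simp add: algebra_simps)
      show "real k ^ 2 * \<mu> \<le> (real k ^ 2 - 4 * real k + 2) * \<sigma> 3"
        unfolding S_def[symmetric] kx(1) using fa by (simp add: algebra_simps power2_eq_square)
    qed (use N 3 in auto)
  qed
qed

section \<open>The exponent \<open>k = 3\<close>\<close>

lemma far_after_four_gaps:
  fixes a a' :: nat and f :: "nat \<Rightarrow> nat" and n :: int
  assumes n0: "n \<noteq> 0" and a: "a < a'" and f: "\<And>i. i < 4 \<Longrightarrow> f i < f (Suc i)"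
    and pw: "\<And>i. i \<le> 4 \<Longrightarrow> shifted_power 3 n a (f i) \<and> shifted_power 3 n a' (f i)"
    and \<mu>: "\<mu> = ln \<bar>real_of_int n\<bar>"
    and gap: "\<And>i. i < 4 \<Longrightarrow> 2 * (ln a + ln (f i)) \<le> 3 * \<mu> + ln a' + ln (f (Suc i))"
    and large: "5 * ln a' + 9 * \<mu> + 14 \<le> ln a + ln (f 0)"
  shows False
proof -
  define \<sigma> where "\<sigma> = ln (real a) + ln (real (f 0))"
  define e where "e = \<sigma> - ln a' - 2 * \<mu> - 2 * ln 3"
  define h where "h = ln 5 + 2 * ln 3 + ln a' + \<sigma>"
  have pos: "0 < a" "0 < a'" using pw[of 0] by (auto simp: shifted_power_def)
  have \<mu>0: "\<mu> \<ge> 0" using n0 by (auto simp: \<mu>)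
  have la: "ln (real a) \<ge> 0" "ln (real a') \<ge> 0" "ln (real a) \<le> ln (real a')" using pos a by auto
  note lnb = ln_numeral_bounds ln_4_6_16
  have f04: "f 0 < f 4" using f[of 0] f[of 1] f[of 2] f[of 3] by (simp add: numeral_eq_Suc)
  have \<sigma>4: "16 * \<sigma> - 15 * (ln a' - ln a) - 45 * \<mu> \<le> ln a + ln (f 4)"
    using gap[of 0] gap[of 1] gap[of 2] gap[of 3] by (simp add: \<sigma>_def numeral_eq_Suc)
  show False
  \<comment> \<open>Each gap only doubles the logarithm here. After four gaps the right side of the
    final condition is about \<open>17 * \<sigma>\<close>, which leaves room for the
    \<open>15 * \<sigma>\<close> that \<open>r0 = 5\<close> puts on the left.\<close>
  proof (rule no_far_solution[of 3 n a a' "f 0" "f 4" \<mu> \<sigma> e h 5])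
    show "ln 16 + \<mu> \<le> \<sigma>" using large la \<mu>0 lnb by (simp add: \<sigma>_def)
    show "h \<le> (real 3 - 1) * e" using large la \<mu>0 lnb by (simp add: h_def e_def \<sigma>_def)
    show "real 3 * \<mu> + ln a' + (real 5 + 1) * h \<le> (real 3 - 2) * \<sigma> + (real 3 - 1) * ((real 5 - 1) * e)"
      using large la \<mu>0 lnb by (simp add: h_def e_def \<sigma>_def)
    have "ln (3::real) > 0" by simp
    then show "real 3 * (\<sigma> + (real 5 - 1) * e) < real 3 * \<mu> + ln a' + \<sigma> + ln (f 4)"
      using large la \<mu>0 \<sigma>4 unfolding \<sigma>_def[symmetric] e_def of_nat_numeral by argo
  qed (use n0 a f04 pw[of 0] pw[of 4] \<mu> in \<open>auto simp: \<sigma>_def e_def h_def\<close>)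
qed

text \<open>The loss \<open>c\<close> is the fixed point of the map from \<sigma> to
  \<open>2 * \<sigma> - c\<close>, so the distance to it at least doubles at every gap.\<close>

lemma power_grid_cube_growth:
  assumes g: "power_grid 3 n N a b" and n0: "n \<noteq> 0" and \<mu>: "\<mu> = ln \<bar>real_of_int n\<bar>"
    and c: "c = 3 * \<mu> + ln (a 1) - ln (a 0)" and j: "0 < j" "j + i < N" and N: "2 \<le> N"
  shows "2 ^ i * (ln (a 0) + ln (b j) - c) \<le> ln (a 0) + ln (b (j + i)) - c"
  using j(2)
proof (induction i)
  case (Suc i)
  have "2 * (ln (a 0) + ln (b (j + i))) \<le> 3 * \<mu> + ln (a 1) + ln (b (j + Suc i))"
    using power_grid_gap[OF g _ n0, of 0 1 "j + i" "j + Suc i"] j N Suc.prems by (simp add: \<mu>)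
  then have "2 * (ln (a 0) + ln (b (j + i)) - c) \<le> ln (a 0) + ln (b (j + Suc i)) - c"
    by (simp add: c)
  moreover have "2 * (2 ^ i * (ln (a 0) + ln (b j) - c)) \<le> 2 * (ln (a 0) + ln (b (j + i)) - c)"
    using Suc by (intro mult_left_mono) auto
  ultimately show ?case by (simp only: power_Suc mult.assoc)
qed simp

lemma no_power_grid_3_of_large:
  assumes g: "power_grid 3 n N a b" and n0: "n \<noteq> 0" and \<mu>: "\<mu> = ln \<bar>real_of_int n\<bar>"
    and J: "0 < J" "J + 5 \<le> N" and large: "5 * ln (a 1) + 9 * \<mu> + 14 \<le> ln (a 0) + ln (b J)"
  shows False
proof (rule far_after_four_gaps[OF n0, of "a 0" "a 1" "\<lambda>i. b (J + i)" \<mu>])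
  show "2 * (ln (a 0) + ln (b (J + i))) \<le> 3 * \<mu> + ln (a 1) + ln (b (J + Suc i))" if "i < 4" for i
    using power_grid_gap[OF g _ n0, of 0 1 "J + i" "J + Suc i"] J that by (simp add: \<mu>)
qed (use power_grid_less[OF g] power_grid_shifted_power[OF g] J \<mu> large in auto)

text \<open>In this skew case \<open>ln (a 1) \<le> s\<close> is at most half of
  \<open>ln (a 0) + ln (b 1)\<close>. The loss \<open>c\<close> then leaves at least
  \<open>s - 3 * \<mu>\<close> in column \<open>1\<close>, from where the doubling starts.\<close>

lemma no_power_grid_3_skew:
  assumes g: "power_grid 3 n N a b" and n0: "n \<noteq> 0" and \<mu>: "\<mu> = ln \<bar>real_of_int n\<bar>"
    and J: "2 \<le> J" "J + 5 \<le> N"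
    and s: "s = ln (a 1) + ln (b 0)" and s': "2 * s \<le> ln (a 0) + ln (b 1)"
    and large: "8 * s + 6 * \<mu> + 14 \<le> 2 ^ (J - 2) * (s - 9/2 * \<mu>)"
  shows False
proof -
  define c where "c = 3 * \<mu> + ln (a 1) - ln (a 0)"
  have \<mu>0: "\<mu> \<ge> 0" using n0 by (auto simp: \<mu>)
  have p: "0 < a 0" "0 < a 1" "0 < b 0" "a 0 < a 1"
    using power_grid_pos[OF g] power_grid_less[OF g] J by auto
  have la: "ln (real (a 0)) \<ge> 0" "ln (real (a 0)) \<le> ln (real (a 1))" "ln (real (a 1)) \<le> s" using p by (auto simp: s)
  have grow: "2 ^ (J - 1) * (ln (a 0) + ln (b 1) - c) \<le> ln (a 0) + ln (b J) - c"
    using power_grid_cube_growth[OF g n0 \<mu> c_def, of 1 "J - 1"] J by simp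
  have "J - 1 = Suc (J - 2)" using J by simp
  then have "(2::real) ^ (J - 1) = 2 * 2 ^ (J - 2)" by simp
  moreover have "s - 9/2 * \<mu> > 0"
  proof -
    have "0 < 2 ^ (J - 2) * (s - 9/2 * \<mu>)" using large la \<mu>0 by linarith
    then show ?thesis by (simp add: zero_less_mult_iff)
  qed
  moreover have "s - 9/2 * \<mu> \<le> ln (a 0) + ln (b 1) - c" using s' la \<mu>0 by (simp add: c_def)
  ultimately have "2 ^ (J - 2) * (s - 9/2 * \<mu>) \<le> 2 ^ (J - 1) * (ln (a 0) + ln (b 1) - c)"
    by (intro mult_mono) auto
  then have "8 * s + 6 * \<mu> + 14 \<le> ln (a 0) + ln (b J) - c" using grow large by linarith
  then have "5 * ln (a 1) + 9 * \<mu> + 14 \<le> ln (a 0) + ln (b J)" using la \<mu>0 by (simp add: c_def)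
  then show False using no_power_grid_3_of_large[OF g n0 \<mu> _ J(2)] J by simp
qed

text \<open>Here \<open>c\<close> may consume all of column \<open>1\<close>. Instead the diagonal
  gap from \<open>(1, 1)\<close> to \<open>(2, 2)\<close> with \<open>a 2 \<le> b 2\<close> bounds
  \<open>ln (b 2)\<close> below by \<open>ln (a 1) + ln (b 1) - 3/2 * \<mu>\<close>, and the
  doubling starts in column \<open>2\<close>. The loss \<open>9/2 * \<mu>\<close> is this
  \<open>3/2 * \<mu>\<close> plus the \<open>3 * \<mu>\<close> in \<open>c\<close>. As
  \<open>ln (a 1) \<le> 2 * s\<close>, the term \<open>8 * s\<close> covers four of the five copies
  of \<open>ln (a 1)\<close>, and \<open>c\<close> supplies the fifth.\<close>

lemma no_power_grid_3_balanced:
  assumes g: "power_grid 3 n N a b" and n0: "n \<noteq> 0" and \<mu>: "\<mu> = ln \<bar>real_of_int n\<bar>"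
    and J: "2 \<le> J" "J + 5 \<le> N"
    and s: "s = ln (a 0) + ln (b 1)" and s': "ln (a 1) + ln (b 0) \<le> 2 * s"
    and ab: "a 2 \<le> b 2"
    and large: "8 * s + 6 * \<mu> + 14 \<le> 2 ^ (J - 2) * (s - 9/2 * \<mu>)"
  shows False
proof -
  define c where "c = 3 * \<mu> + ln (a 1) - ln (a 0)"
  have \<mu>0: "\<mu> \<ge> 0" using n0 by (auto simp: \<mu>)
  have p: "0 < a 0" "0 < a 1" "0 < b 0" "0 < a 2" "a 0 < a 1"
    using power_grid_pos[OF g] power_grid_less[OF g] J by auto
  have la: "ln (real (a 0)) \<ge> 0" "ln (real (a 0)) \<le> ln (real (a 1))" "ln (real (b 0)) \<ge> 0" using p by auto
  have ab': "ln (real (a 2)) \<le> ln (real (b 2))" using ab p by simp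
  have grow: "2 ^ (J - 2) * (ln (a 0) + ln (b 2) - c) \<le> ln (a 0) + ln (b J) - c"
    using power_grid_cube_growth[OF g n0 \<mu> c_def, of 2 "J - 2"] J by (simp del: add_2_eq_Suc)
  have "2 * (ln (a 1) + ln (b 1)) \<le> 3 * \<mu> + ln (a 2) + ln (b 2)"
    using power_grid_gap[OF g _ n0, of 1 2 1 2] J by (simp add: \<mu>)
  then have "s + ln (a 0) - 9/2 * \<mu> \<le> ln (a 0) + ln (b 2) - c" using ab' by (simp add: c_def s)
  then have "2 ^ (J - 2) * (s + ln (a 0) - 9/2 * \<mu>) \<le> 2 ^ (J - 2) * (ln (a 0) + ln (b 2) - c)"
    by (intro mult_left_mono) auto
  moreover have "1 * ln (a 0) \<le> 2 ^ (J - 2) * ln (a 0)" using la by (intro mult_right_mono) auto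
  ultimately have "8 * s + 6 * \<mu> + 14 + ln (a 0) \<le> ln (a 0) + ln (b J) - c"
    using grow large by (simp add: algebra_simps)
  then have "5 * ln (a 1) + 9 * \<mu> + 14 \<le> ln (a 0) + ln (b J)" using la s' \<mu>0 by (simp add: c_def)
  then show False using no_power_grid_3_of_large[OF g n0 \<mu> _ J(2)] J by simp
qed

text \<open>Either one of the two off-corner sums is at least twice the other, or they are
  comparable and \<open>a 2\<close>, \<open>b 2\<close> can be ordered. Exchanging \<open>a\<close>
  and \<open>b\<close> reduces the four cases to the two previous lemmas.\<close>

lemma no_power_grid_3:
  assumes g: "power_grid 3 n N a b" and n0: "n \<noteq> 0" and \<mu>: "\<mu> = ln \<bar>real_of_int n\<bar>"
    and J: "2 \<le> J" "J + 5 \<le> N"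
    and large: "\<And>s. s \<in> {ln (a 0) + ln (b 1), ln (a 1) + ln (b 0)} \<Longrightarrow>
      8 * s + 6 * \<mu> + 14 \<le> 2 ^ (J - 2) * (s - 9/2 * \<mu>)"
  shows False
proof -
  note g' = power_grid_commute[OF g]
  define s where "s = ln (real (a 0)) + ln (real (b 1))"
  define s' where "s' = ln (real (a 1)) + ln (real (b 0))"
  have s2: "s = ln (real (b 1)) + ln (real (a 0))" "s' = ln (real (b 0)) + ln (real (a 1))"
    by (simp_all add: s_def s'_def)
  have L: "8 * s + 6 * \<mu> + 14 \<le> 2 ^ (J - 2) * (s - 9/2 * \<mu>)" "8 * s' + 6 * \<mu> + 14 \<le> 2 ^ (J - 2) * (s' - 9/2 * \<mu>)"
    unfolding s_def s'_def by (rule large, simp)+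
  consider "2 * s' \<le> s" | "2 * s \<le> s'" | "s \<le> 2 * s'" "s' \<le> 2 * s" "a 2 \<le> b 2" | "s \<le> 2 * s'" "s' \<le> 2 * s" "b 2 \<le> a 2"
    by linarith
  then show False
  proof cases
    case 1 then show False using no_power_grid_3_skew[OF g n0 \<mu> J s'_def _ L(2)] by (simp add: s_def)
  next
    case 2 then show False using no_power_grid_3_skew[OF g' n0 \<mu> J s2(1) _ L(1)] by (simp add: s2)
  next
    case 3 then show False using no_power_grid_3_balanced[OF g n0 \<mu> J s_def _ _ L(1)] by (simp add: s'_def)
  next
    case 4 then show False using no_power_grid_3_balanced[OF g' n0 \<mu> J s2(2) _ _ L(2)] by (simp add: s2)
  qed
qed

section \<open>Bounding the size of bipartite tuples\<close>

lemma ecard_enumerate: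
  fixes A :: "nat set"
  assumes "enat N \<le> ecard A"
  obtains f where "strict_mono_on {..<N} f" "f ` {..<N} \<subseteq> A"
proof -
  obtain C where C: "C \<subseteq> A" "finite C" "card C = N"
  proof (cases "finite A")
    case True
    then have "N \<le> card A" using assms by (simp add: ecard_def)
    then show ?thesis using that obtain_subset_with_card_n by metis
  next
    case False
    then show ?thesis using that infinite_arbitrarily_large by metis
  qed
  obtain f where "bij_betw f {..<card C} C" "strict_mono_on {..<card C} f"
    using ex_bij_betw_strict_mono_card[OF C(2)] by metis
  then show ?thesis using that C by (auto simp: bij_betw_def)
qed

section \<open>The case \<open>\<bar>n\<bar> = 1\<close>\<close>

lemma shifted_power_unit_ge:
  assumes "shifted_power k n a b" "\<bar>n\<bar> = 1" "int a * int b + n \<ge> 2"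
  shows "2 ^ k \<le> real a * real b + 1"
proof -
  obtain x :: nat where x: "x \<ge> 1" "int a * int b + n = int x ^ k"
    using assms by (auto simp: shifted_power_def)
  have "x \<noteq> 1" using x assms(3) by auto
  then have "int 2 ^ k \<le> int x ^ k" using x by (intro power_mono) auto
  then have "2 ^ k \<le> int a * int b + 1" using x assms(2) by simp
  then have "real_of_int (2 ^ k) \<le> real_of_int (int a * int b + 1)" by (simp only: of_int_le_iff)
  then show ?thesis by simp
qed

text \<open>The power in the corner is at least \<open>1\<close>, so those in the cells
  \<open>(0, 1)\<close> and \<open>(1, 0)\<close> are at least \<open>2\<close> and hence at least
  \<open>2^k\<close>. This gives the initial size \<open>ln (2^k - 1)\<close>, while
  \<open>\<mu> = 0\<close>.\<close>

lemma no_power_grid_unit: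
  assumes k: "k \<ge> 3" and n: "\<bar>n\<bar> = 1"
    and mono: "strict_mono_on {..<r_bd k + 2} a" "strict_mono_on {..<r_bd k + 2} b"
    and pw: "\<And>i j. i < r_bd k + 2 \<Longrightarrow> j < r_bd k + 2 \<Longrightarrow> shifted_power k n (a i) (b j)"
  shows False
proof -
  define N where "N = r_bd k + 2"
  have n0: "n \<noteq> 0" using n by auto
  have ord: "a 0 < a 1" "b 0 < b 1" using mono by (auto simp: strict_mono_on_def)
  have pos: "a 0 > 0" "b 0 > 0" using pw[of 0 0] by (auto simp: shifted_power_def)
  have p00: "int (a 0) * int (b 0) + n \<ge> 1"
    using pw[of 0 0] by (auto simp: shifted_power_def)
  have "int (a 0) * int (b 0) + int (a 0) \<le> int (a 0) * int (b 1)"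
    using ord pos mult_left_mono[of "int (b 0) + 1" "int (b 1)" "int (a 0)"] by (simp add: algebra_simps)
  then have l1: "2 ^ k \<le> real (a 0) * real (b 1) + 1"
    using pos p00 by (intro shifted_power_unit_ge[OF pw n]) auto
  have "int (a 0) * int (b 0) + int (b 0) \<le> int (a 1) * int (b 0)"
    using ord pos mult_right_mono[of "int (a 0) + 1" "int (a 1)" "int (b 0)"] by (simp add: algebra_simps)
  then have l2: "2 ^ k \<le> real (a 1) * real (b 0) + 1"
    using pos p00 by (intro shifted_power_unit_ge[OF pw n]) auto
  have k8: "(8::real) \<le> 2 ^ k" using power_increasing[OF k, of "2::real"] by simp
  have n1: "\<bar>real_of_int n\<bar> = 1" using n by (metis of_int_1 of_int_abs)
  have g: "power_grid k n N a b"
    unfolding power_grid_def N_def using mono pw l1 l2 k8 n1 by auto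
  have posr: "0 < real (a 0)" "0 < real (a 1)" "0 < real (b 0)" "0 < real (b 1)" using pos ord by auto
  have ln1: "ln c \<le> ln (a 0) + ln (b 1)" "ln c \<le> ln (a 1) + ln (b 0)" if "c + 1 \<le> 2 ^ k" "c > 0" for c :: real
  proof -
    have "ln c \<le> ln (real (a 0) * real (b 1))" "ln c \<le> ln (real (a 1) * real (b 0))"
      using that l1 l2 posr by (subst ln_le_cancel_iff; force)+
    then show "ln c \<le> ln (a 0) + ln (b 1)" "ln c \<le> ln (a 1) + ln (b 0)"
      using posr by (simp_all add: ln_mult)
  qed
  show False
  proof (cases "k = 3")
    case True
    have N: "N = 11" by (simp add: N_def r_bd_def True)
    have s7: "ln 7 \<le> ln (a 0) + ln (b 1)" "ln 7 \<le> ln (a 1) + ln (b 0)"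
      using ln1[of 7] True by auto
    show False
    \<comment> \<open>With \<open>J = 6\<close> the condition reads
      \<open>8 * s + 14 \<le> 16 * s\<close>, that is \<open>s \<ge> 7/4\<close>, which
      \<open>ln 7\<close> satisfies; and \<open>J + 5\<close> is the grid size
      \<open>11\<close>.\<close>
    proof (rule no_power_grid_3[OF g[unfolded True] n0, of "0::real" 6])
      show "8 * s + 6 * 0 + 14 \<le> 2 ^ (6 - 2) * (s - 9/2 * 0)"
        if "s \<in> {ln (a 0) + ln (b 1), ln (a 1) + ln (b 0)}" for s :: real
      proof -
        have "ln 7 \<le> s" using that s7 by auto
        then show ?thesis using ln_numeral_bounds(5) by simp
      qed
    qed (use n1 N in auto)
  next
    case False
    then have k4: "k \<ge> 4" using k by simp
    have N: "N = (if k = 4 then 8 else if k = 5 then 7 else 6)"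
      using False by (simp add: N_def r_bd_def)
    have "(16::real) \<le> 2 ^ k" using power_increasing[OF k4, of "2::real"] by simp
    then have s15: "ln 15 \<le> ln (a 0) + ln (b 1)" "ln 15 \<le> ln (b 0) + ln (a 1)" using ln1[of 15] by auto
    have s: "5/2 \<le> ln (a 0) + ln (b 1)" "5/2 \<le> ln (b 0) + ln (a 1)"
      using s15 ln_numeral_bounds(6) by linarith+
    have mu: "0 = ln \<bar>real_of_int n\<bar>" by (simp add: n1)
    show False
    proof (cases "a 1 \<le> b 1")
      case True
      show False
        using no_power_grid_ge_4[OF g k4 n0 True N refl s(1) mu] s k4 by simp
    next
      case False
      then show False
        using no_power_grid_ge_4[OF power_grid_commute[OF g] k4 n0 _ N refl s(2) mu] s k4 by simp
    qed
  qed
qed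

text \<open>The two terms of \<open>M\<close> supply what the grid lemmas ask for:
  \<open>4 * n^2\<close> is at least \<open>4 * \<bar>n\<bar>\<close> and at least
  \<open>16\<close>, so the gap principle applies and \<open>s \<ge> 8/3\<close>, and the other term
  bounds \<mu> in terms of \<open>s\<close>.\<close>

lemma no_power_grid_of_large:
  assumes k: "k \<ge> 3" and n: "\<bar>n\<bar> \<ge> 2"
    and M: "M = max (4 * (real_of_int \<bar>n\<bar>)\<^sup>2) (real_of_int \<bar>n\<bar> powr (2 * (real k + 1) / (real k - 2)))"
    and mono: "strict_mono_on {..<21::nat} a" "strict_mono_on {..<21::nat} b"
    and pw: "\<And>i j. i < 21 \<Longrightarrow> j < 21 \<Longrightarrow> shifted_power k n (a i) (b j)"
    and large: "\<And>i j. i < 21 \<Longrightarrow> j < 21 \<Longrightarrow> M < real (a i) * real (b j)"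
  shows False
proof -
  have n0: "n \<noteq> 0" using n by auto
  define \<nu> where "\<nu> = \<bar>real_of_int n\<bar>"
  have \<nu>: "\<nu> \<ge> 2" using n unfolding \<nu>_def by linarith
  have M': "4 * \<nu>\<^sup>2 \<le> M" "\<nu> powr (2 * (real k + 1) / (real k - 2)) \<le> M"
    by (simp_all add: M \<nu>_def)
  have "\<nu> * 1 \<le> \<nu> * \<nu>" using \<nu> by (intro mult_left_mono) auto
  then have M4: "4 * \<nu> \<le> M" using M' by (simp add: power2_eq_square)
  have "2 * 2 \<le> \<nu> * \<nu>" using \<nu> by (intro mult_mono) auto
  then have M16: "16 \<le> M" using M' by (simp add: power2_eq_square)
  have posr: "0 < real (a i)" "0 < real (b i)" if "i < 21" for i
    using pw[OF that that] by (auto simp: shifted_power_def)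
  have g: "power_grid k n N a b" if "2 \<le> N" "N \<le> 21" for N
    unfolding power_grid_def using that mono pw M4 large[of 0 1] large[of 1 0]
    by (auto simp: strict_mono_on_def \<nu>_def)
  define \<mu> where "\<mu> = ln \<nu>"
  have \<mu>0: "\<mu> \<ge> 0" using \<nu> by (simp add: \<mu>_def)
  have s: "8/3 \<le> ln (a i) + ln (b j)" "2 * (real k + 1) * \<mu> \<le> (real k - 2) * (ln (a i) + ln (b j))"
    if "i < 21" "j < 21" for i j
  proof -
    have "ln 16 \<le> ln (real (a i) * real (b j))"
      using large[OF that] M16 posr that by (subst ln_le_cancel_iff) auto
    then show "8/3 \<le> ln (a i) + ln (b j)"
      using ln_numeral_bounds ln_4_6_16 posr that by (simp add: ln_mult)
    have "ln (\<nu> powr (2 * (real k + 1) / (real k - 2))) \<le> ln (real (a i) * real (b j))"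
      using large[OF that] M'(2) posr that \<nu> by (subst ln_le_cancel_iff) auto
    then have "2 * (real k + 1) / (real k - 2) * \<mu> \<le> ln (a i) + ln (b j)"
      using posr that \<nu> by (simp add: ln_mult ln_powr \<mu>_def)
    then have "(real k - 2) * (2 * (real k + 1) / (real k - 2) * \<mu>) \<le> (real k - 2) * (ln (a i) + ln (b j))"
      using k by (intro mult_left_mono) auto
    then show "2 * (real k + 1) * \<mu> \<le> (real k - 2) * (ln (a i) + ln (b j))" using k by simp
  qed
  show False
  proof (cases "k = 3")
    case True
    show False
    \<comment> \<open>For \<open>k = 3\<close> the exponent of the second term is \<open>8\<close>,
      so \<open>8 * \<mu> \<le> s\<close> and \<open>s - 9/2 * \<mu>\<close> is at least
      \<open>7/16 * s\<close>. With \<open>J = 9\<close> the right side is at least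
      \<open>56 * s\<close>, and \<open>J + 5 = 14\<close>.\<close>
    proof (rule no_power_grid_3[of n 14 a b \<mu> 9])
      show "8 * s + 6 * \<mu> + 14 \<le> 2 ^ (9 - 2) * (s - 9/2 * \<mu>)"
        if "s \<in> {ln (a 0) + ln (b 1), ln (a 1) + ln (b 0)}" for s :: real
      proof -
        have "8/3 \<le> s \<and> 8 * \<mu> \<le> s" using that s[of 0 1] s[of 1 0] True by auto
        then show ?thesis using \<mu>0 by simp
      qed
    qed (use g[of 14] True n0 in \<open>auto simp: \<mu>_def \<nu>_def\<close>)
  next
    case False
    then have k4: "k \<ge> 4" using k by simp
    define N where "N = (if k = 4 then 8 else if k = 5 then 7 else 6 :: nat)"
    have gN: "power_grid k n N a b" by (rule g) (auto simp: N_def)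
    have s': "5/2 \<le> ln (a 0) + ln (b 1)" "5/2 \<le> ln (b 0) + ln (a 1)"
      "2 * (real k + 1) * \<mu> \<le> (real k - 2) * (ln (b 0) + ln (a 1))"
      using s[of 0 1] s[of 1 0] by (auto simp: add.commute)
    have mu: "\<mu> = ln \<bar>real_of_int n\<bar>" by (simp add: \<mu>_def \<nu>_def)
    show False
    proof (cases "a 1 \<le> b 1")
      case True
      show False
        using no_power_grid_ge_4[OF gN k4 n0 True N_def refl s'(1) mu] s[of 0 1] by simp
    next
      case False
      then show False
        using no_power_grid_ge_4[OF power_grid_commute[OF gN] k4 n0 _ N_def refl s'(2) mu] s'(3) by simp
    qed
  qed
qed

section \<open>From pairs of sets to grids of solutions\<close>

lemma BD_shifted_power:
  assumes "BD k n A B" "a \<in> A" "b \<in> B"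
  shows "shifted_power k n a b"
proof -
  have "a \<ge> 1" "b \<ge> 1" using assms unfolding BD_def by (meson atLeast_iff subsetD)+
  moreover have "int a * int b + n \<in> {int x ^ k | x :: nat. x \<ge> 1}"
    using assms unfolding BD_def by blast
  ultimately show ?thesis unfolding shifted_power_def by auto
qed

text \<open>For fixed \<open>a\<close>, the \<open>k\<close>-th root of \<open>ab + n\<close>
  determines \<open>b\<close>, and it is a positive integer not exceeding the \<open>k\<close>-th
  root of \<open>M + n\<close>.\<close>

lemma card_small_le:
  assumes k: "k \<ge> 1" and pw: "\<And>b. b \<in> B \<Longrightarrow> shifted_power k n a b" and small: "\<And>b. b \<in> B \<Longrightarrow> real a * real b \<le> M"
    and T: "0 < M + real_of_int n"
  shows "finite B" "card B \<le> nat \<lfloor>(M + real_of_int n) powr (1 / real k)\<rfloor>"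
proof -
  define F where "F = nat \<lfloor>(M + real_of_int n) powr (1 / real k)\<rfloor>"
  define x where "x = (\<lambda>b. SOME x::nat. x > 0 \<and> real x ^ k = real a * real b + of_int n)"
  have x: "x b > 0 \<and> real (x b) ^ k = real a * real b + of_int n" if "b \<in> B" for b
    unfolding x_def by (rule someI_ex) (use shifted_powerE[OF pw[OF that]] in metis)
  have inj: "inj_on x B"
  proof (rule inj_onI)
    fix b c assume bc: "b \<in> B" "c \<in> B" "x b = x c"
    then have "a = 0 \<or> b = c" using x[of b] x[of c] by auto
    then show "b = c" using pw[OF bc(1)] by (auto simp: shifted_power_def)
  qed
  have sub: "x ` B \<subseteq> {1..F}"
  proof
    fix y assume "y \<in> x ` B"
    then obtain b where b: "b \<in> B" "y = x b" by auto
    have y: "0 < real y" "real y ^ k \<le> M + real_of_int n" using x[OF b(1)] small[OF b(1)] b by auto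
    have "real y = (real y ^ k) powr (1 / real k)"
      using y k by (simp add: powr_realpow[symmetric] powr_powr)
    also have "\<dots> \<le> (M + real_of_int n) powr (1 / real k)" using y by (intro powr_mono2) auto
    finally have "int y \<le> \<lfloor>(M + real_of_int n) powr (1 / real k)\<rfloor>" by (simp add: le_floor_iff)
    then show "y \<in> {1..F}" using y by (simp add: F_def)
  qed
  show "finite B" using inj sub by (meson finite_atLeastAtMost finite_imageD finite_subset)
  have "card B = card (x ` B)" using inj by (simp add: card_image)
  also have "\<dots> \<le> F" using card_mono[OF _ sub] by simp
  finally show "card B \<le> nat \<lfloor>(M + real_of_int n) powr (1 / real k)\<rfloor>" by (simp add: F_def)
qed

lemma BM_le:
  assumes "\<And>A B. BD k n A B \<Longrightarrow> enat (Suc L) \<le> ecard A \<Longrightarrow> enat (Suc L) \<le> ecard B \<Longrightarrow> False"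
  shows "BM k n \<le> enat L"
  unfolding BM_def
proof (rule Sup_least)
  fix m assume "m \<in> {min (ecard A) (ecard B) |A B. BD k n A B}"
  then obtain A B where m: "m = min (ecard A) (ecard B)" "BD k n A B" by auto
  show "m \<le> enat L"
  proof (rule ccontr)
    assume "\<not> m \<le> enat L"
    then have "eSuc (enat L) \<le> m" by (simp add: ileI1)
    then have "enat (Suc L) \<le> ecard A" "enat (Suc L) \<le> ecard B" using m(1) by (auto simp: eSuc_enat)
    then show False using assms m(2) by blast
  qed
qed

theorem theorem2p1:
  fixes k :: nat and n :: int
  assumes "k \<ge> 3" and "n \<noteq> 0"
  shows "(\<bar>n\<bar> = 1 \<longrightarrow> BM k n \<le> enat (r_bd k + 1)) \<and>
         (\<bar>n\<bar> \<ge> 2 \<longrightarrow>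
            ereal_of_enat (BM k n) \<le> ereal (max
              ((ln (ln (real_of_int \<bar>n\<bar>)) + 3.3) / ln (real k - 1) + 8)
              ((max (4 * (real_of_int \<bar>n\<bar>)\<^sup>2)
                    (real_of_int \<bar>n\<bar> powr (2 * (real k + 1) / (real k - 2)))
                + real_of_int n) powr (1 / real k) + 20)))"
proof (intro conjI impI)
  assume n: "\<bar>n\<bar> = 1"
  show "BM k n \<le> enat (r_bd k + 1)"
  proof (rule BM_le)
    fix A B assume BD: "BD k n A B" and card: "enat (Suc (r_bd k + 1)) \<le> ecard A" "enat (Suc (r_bd k + 1)) \<le> ecard B"
    obtain a where a: "strict_mono_on {..<r_bd k + 2} a" "a ` {..<r_bd k + 2} \<subseteq> A"
      using ecard_enumerate[OF card(1)] by auto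
    obtain b where b: "strict_mono_on {..<r_bd k + 2} b" "b ` {..<r_bd k + 2} \<subseteq> B"
      using ecard_enumerate[OF card(2)] by auto
    show False
      using no_power_grid_unit[OF assms(1) n a(1) b(1)] BD_shifted_power[OF BD] a(2) b(2) by blast
  qed
next
  assume n: "\<bar>n\<bar> \<ge> 2"
  define M where "M = max (4 * (real_of_int \<bar>n\<bar>)\<^sup>2) (real_of_int \<bar>n\<bar> powr (2 * (real k + 1) / (real k - 2)))"
  define R where "R = (M + real_of_int n) powr (1 / real k)"
  define F where "F = nat \<lfloor>R\<rfloor>"
  \<comment> \<open>The delicate sign is \<open>n < 0\<close>, where
    \<open>4 * n^2 \<ge> 4 * \<bar>n\<bar>\<close> keeps the base of the power positive.\<close>
  have T: "M + real_of_int n > 0"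
  proof -
    have \<nu>: "real_of_int \<bar>n\<bar> \<ge> 2" using n by linarith
    have "real_of_int \<bar>n\<bar> * 1 \<le> real_of_int \<bar>n\<bar> * real_of_int \<bar>n\<bar>" using \<nu> by (intro mult_left_mono) auto
    then have "4 * real_of_int \<bar>n\<bar> \<le> 4 * (real_of_int \<bar>n\<bar>)\<^sup>2" by (simp add: power2_eq_square)
    also have "\<dots> \<le> M" by (simp add: M_def)
    finally show ?thesis using \<nu> by linarith
  qed
  have "BM k n \<le> enat (F + 20)"
  proof (rule BM_le)
    fix A B assume BD: "BD k n A B" and card: "enat (Suc (F + 20)) \<le> ecard A" "enat (Suc (F + 20)) \<le> ecard B"
    have "enat 21 \<le> enat (Suc (F + 20))" by simp
    then have "enat 21 \<le> ecard A" using card(1) by (rule order_trans)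
    then obtain a where a: "strict_mono_on {..<21::nat} a" "a ` {..<21} \<subseteq> A"
      by (rule ecard_enumerate)
    have a0: "a 0 \<in> A" using a(2) by auto
    \<comment> \<open>At most \<open>F\<close> elements of \<open>B\<close> have a small product
      with the least chosen \<open>a\<close>. Of the at least \<open>F + 21\<close> elements of
      \<open>B\<close>, at least \<open>21\<close> remain.\<close>
    define B0 where "B0 = {b \<in> B. real (a 0) * real b \<le> M}"
    have pw0: "shifted_power k n (a 0) b" "real (a 0) * real b \<le> M" if "b \<in> B0" for b
      using that BD_shifted_power[OF BD a0, of b] by (simp_all add: B0_def)
    have B0: "finite B0" "card B0 \<le> F"
      unfolding F_def R_def using assms(1) pw0 T by (intro card_small_le[of k B0 n "a 0" M]; simp)+
    have "enat 21 \<le> ecard (B - B0)"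
    proof (cases "finite B")
      case True
      then have "card (B - B0) = card B - card B0" using B0 by (intro card_Diff_subset) (auto simp: B0_def)
      then show ?thesis using True card(2) B0(2) by (simp add: ecard_def)
    next
      case False
      then show ?thesis using B0 by (simp add: ecard_def)
    qed
    then obtain b where b: "strict_mono_on {..<21::nat} b" "b ` {..<21} \<subseteq> B - B0"
      by (rule ecard_enumerate)
    show False
    proof (rule no_power_grid_of_large[OF assms(1) n M_def a(1) b(1)])
      fix i j :: nat assume ij: "i < 21" "j < 21"
      have ai: "a i \<in> A" and bj: "b j \<in> B" "b j \<notin> B0" using a(2) b(2) ij by auto
      show "shifted_power k n (a i) (b j)" by (rule BD_shifted_power[OF BD ai bj(1)])
      \<comment> \<open>Since \<open>a 0\<close> is the least row, excluding the small products for
        it excludes them for all rows.\<close>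
      have "a 0 \<le> a i" using a(1) ij by (cases "i = 0") (auto simp: strict_mono_on_def intro: less_imp_le)
      then have "real (a 0) * real (b j) \<le> real (a i) * real (b j)" by (intro mult_right_mono) auto
      moreover have "M < real (a 0) * real (b j)" using bj by (simp add: B0_def)
      ultimately show "M < real (a i) * real (b j)" by simp
    qed
  qed
  then have "ereal_of_enat (BM k n) \<le> ereal_of_enat (enat (F + 20))"
    by (simp only: ereal_of_enat_le_iff)
  also have "\<dots> = ereal (real F + 20)" by simp
  also have "\<dots> \<le> ereal (max ((ln (ln (real_of_int \<bar>n\<bar>)) + 3.3) / ln (real k - 1) + 8) (R + 20))"
  proof -
    have "real F \<le> R" by (simp add: F_def R_def)
    then show ?thesis by (intro ereal_less_eq(3)[THEN iffD2] max.coboundedI2) simp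
  qed
  finally show "ereal_of_enat (BM k n) \<le> ereal (max
              ((ln (ln (real_of_int \<bar>n\<bar>)) + 3.3) / ln (real k - 1) + 8)
              ((max (4 * (real_of_int \<bar>n\<bar>)\<^sup>2)
                    (real_of_int \<bar>n\<bar> powr (2 * (real k + 1) / (real k - 2)))
                + real_of_int n) powr (1 / real k) + 20))"
    unfolding R_def M_def .
qed

end
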